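(* There exist a metric space $X$ with a basepoint $e\in X$ and a scaling factor $\alpha=(\alpha_n)_{n\in\mathbb{N}}$ such that for every non-principal ultrafilter $\mu$ on $\mathbb{N}$ the following hold: (i) for all natural numbers $i,j$ with $i\neq j$ the iterated asymptotic cones $\operatorname{Cone}^i_\mu(X,e,\alpha)$ and $\operatorname{Cone}^j_\mu(X,e,\alpha)$ are not homeomorphic; (ii) $X$ has countably many asymptotic cones up to homeomorphism.
   Context: A scaling factor is a sequence $\alpha=(\alpha_n)_{n\in\mathbb{N}}$ of positive real numbers diverging to $+\infty$ (when an ultrafilter $\mu$ is already chosen, it is enough that $\mu\text{-}\lim\alpha_n=+\infty$). For an ultrafilter $\mu$ on $\mathbb{N}$ and a sequence $(x_n)$ in $[0,+\infty]$, $\mu\text{-}\lim x_n$ is the unique $a\in[0,+\infty]$ such that for every neighborhood $U$ of $a$ one has $\{n: x_n\in U\}\in\mu$. Asymptotic cone: for a metric space $(X,d)$, a non-principal ultrafilter $\mu$ on $\mathbb{N}$, a sequence $e=(e_n)$ of points of $X$ (the base-point; a single point $e\in X$ is identified with the constant sequence) and a scaling factor $\alpha$, $\operatorname{Cone}_\mu(X,e,\alpha)$ is the quotient of $\{(x_n)\in X^{\mathbb{N}}: \mu\text{-}\lim d(x_n,e_n)/\alpha_n<+\infty\}$ by the relation $(x_n)\approx(y_n)\iff \mu\text{-}\lim d(x_n,y_n)/\alpha_n=0$, with metric $d_\infty([x_n],[y_n])=\mu\text{-}\lim d(x_n,y_n)/\alpha_n$. The asymptotic cones of $X$ are all spaces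 arising in this way, for arbitrary choices of non-principal ultrafilter, base-point sequence and scaling factor. Iterated asymptotic cones: for $e\in X$ set $\operatorname{Cone}^0_\mu(X,e,\alpha)=X$, $e(0)=e$, and for $i\in\mathbb{N}$ set $\operatorname{Cone}^{i+1}_\mu(X,e,\alpha)=\operatorname{Cone}_\mu(\operatorname{Cone}^i_\mu(X,e,\alpha),e(i),\alpha)$, where $e(i+1)$ is the class of the constant sequence with value $e(i)$. Natural numbers include $0$. *)

theory Defs
  imports "HOL-Analysis.Analysis"
begin

text \<open>
  An ultrafilter is represented by the library's filters: a set of indices belongs to it iff its
  membership predicate holds eventually. The limit along \<open>\<mu>\<close> of a sequence \<open>x\<close> in \<open>[0, \<infinity>]\<close> is
  the library's \<open>Lim \<mu> x\<close> at type \<open>ennreal\<close>; it exists by \<open>ultrafilter_tendsto_Lim\<close>.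
\<close>

definition nonprincipal_ultrafilter :: "nat filter \<Rightarrow> bool" where
  "nonprincipal_ultrafilter \<mu> \<longleftrightarrow>
     \<mu> \<noteq> bot \<and>
     (\<forall>P. eventually P \<mu> \<or> eventually (\<lambda>n. \<not> P n) \<mu>) \<and>
     (\<forall>n. \<mu> \<noteq> principal {n})"

definition scaling_factor :: "(nat \<Rightarrow> real) \<Rightarrow> bool" where
  "scaling_factor \<alpha> \<longleftrightarrow> (\<forall>n. 0 < \<alpha> n) \<and> filterlim \<alpha> at_top sequentially"

text \<open>
  Once the ultrafilter is chosen, divergence along it suffices; \<open>asymptotic_cones\<close> uses this more
  permissive notion, which includes all scaling factors.
\<close>

definition scaling_factor_along :: "nat filter \<Rightarrow> (nat \<Rightarrow> real) \<Rightarrow> bool" where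
  "scaling_factor_along \<mu> \<alpha> \<longleftrightarrow> (\<forall>n. 0 < \<alpha> n) \<and> filterlim \<alpha> at_top \<mu>"

definition lim_dist ::
    "nat filter \<Rightarrow> 'a metric \<Rightarrow> (nat \<Rightarrow> real) \<Rightarrow> (nat \<Rightarrow> 'a) \<Rightarrow> (nat \<Rightarrow> 'a) \<Rightarrow> ennreal" where
  "lim_dist \<mu> X \<alpha> x y = Lim \<mu> (\<lambda>n. ennreal (mdist X (x n) (y n) / \<alpha> n))"

definition admissible ::
    "nat filter \<Rightarrow> 'a metric \<Rightarrow> (nat \<Rightarrow> 'a) \<Rightarrow> (nat \<Rightarrow> real) \<Rightarrow> (nat \<Rightarrow> 'a) set" where
  "admissible \<mu> X e \<alpha> = {x. range x \<subseteq> mspace X \<and> lim_dist \<mu> X \<alpha> x e < \<infinity>}"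

definition cone_rel ::
    "nat filter \<Rightarrow> 'a metric \<Rightarrow> (nat \<Rightarrow> 'a) \<Rightarrow> (nat \<Rightarrow> real) \<Rightarrow> ((nat \<Rightarrow> 'a) \<times> (nat \<Rightarrow> 'a)) set" where
  "cone_rel \<mu> X e \<alpha> =
     {(x, y). x \<in> admissible \<mu> X e \<alpha> \<and> y \<in> admissible \<mu> X e \<alpha> \<and> lim_dist \<mu> X \<alpha> x y = 0}"

text \<open>
  The distance of two classes is computed on chosen representatives; \<open>mspace_Cone\<close> and
  \<open>mdist_Cone\<close> below show that this is a metric on the quotient and that the choice is irrelevant.
\<close>

definition Cone ::
    "nat filter \<Rightarrow> 'a metric \<Rightarrow> (nat \<Rightarrow> 'a) \<Rightarrow> (nat \<Rightarrow> real) \<Rightarrow> (nat \<Rightarrow> 'a) set metric" where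
  "Cone \<mu> X e \<alpha> =
     metric (admissible \<mu> X e \<alpha> // cone_rel \<mu> X e \<alpha>,
             \<lambda>C D. enn2real (lim_dist \<mu> X \<alpha> (SOME x. x \<in> C) (SOME y. y \<in> D)))"

definition asymptotic_cones :: "'a metric \<Rightarrow> (nat \<Rightarrow> 'a) set metric set" where
  "asymptotic_cones X =
     {Cone \<mu> X e \<alpha> | \<mu> e \<alpha>.
        nonprincipal_ultrafilter \<mu> \<and> range e \<subseteq> mspace X \<and> scaling_factor_along \<mu> \<alpha>}"

definition homeomorphism_rel :: "('a metric \<times> 'a metric) set" where
  "homeomorphism_rel = {(Y, Z). mtopology_of Y homeomorphic_space mtopology_of Z}"

text \<open>
  Each application of \<open>Cone\<close> changes the type of the points, so it cannot be iterated as it stands.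
  The iterated cones are therefore formed in a type of names: \<open>Pt a\<close> names the point \<open>a\<close> of the
  initial space and \<open>Cls x\<close> names the equivalence class having the sequence of names \<open>x\<close> as its chosen
  representative. Naming classes is injective (\<open>inj_on_name\<close>), so every \<open>iterated_cone\<close> is an
  isometric copy of the corresponding quotient (\<open>mdist_relabel\<close>).
\<close>

datatype 'a point = Pt 'a | Cls "nat \<Rightarrow> 'a point"

definition name :: "(nat \<Rightarrow> 'a point) set \<Rightarrow> 'a point" where
  "name C = Cls (SOME x. x \<in> C)"

definition relabel :: "('a \<Rightarrow> 'b) \<Rightarrow> 'a metric \<Rightarrow> 'b metric" where
  "relabel f X =
     metric (f ` mspace X,
             \<lambda>p q. mdist X (inv_into (mspace X) f p) (inv_into (mspace X) f q))"

primrec iterated_cone_pointed ::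
    "nat filter \<Rightarrow> 'a metric \<Rightarrow> 'a \<Rightarrow> (nat \<Rightarrow> real) \<Rightarrow> nat \<Rightarrow> 'a point metric \<times> 'a point" where
  "iterated_cone_pointed \<mu> X e \<alpha> 0 = (relabel Pt X, Pt e)"
| "iterated_cone_pointed \<mu> X e \<alpha> (Suc i) =
     (let (Y, p) = iterated_cone_pointed \<mu> X e \<alpha> i
      in (relabel name (Cone \<mu> Y (\<lambda>n. p) \<alpha>),
          name (cone_rel \<mu> Y (\<lambda>n. p) \<alpha> `` {\<lambda>n. p})))"

definition iterated_cone ::
    "nat filter \<Rightarrow> 'a metric \<Rightarrow> 'a \<Rightarrow> (nat \<Rightarrow> real) \<Rightarrow> nat \<Rightarrow> 'a point metric" where
  "iterated_cone \<mu> X e \<alpha> i = fst (iterated_cone_pointed \<mu> X e \<alpha> i)"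


subsection \<open>Well-definedness\<close>

lemma ultrafilter_tendsto_Lim:
  fixes f :: "nat \<Rightarrow> ennreal"
  assumes "nonprincipal_ultrafilter \<mu>"
  shows "(f \<longlongrightarrow> Lim \<mu> f) \<mu>"
proof -
  have nb: "\<mu> \<noteq> bot"
    and u: "\<And>P. eventually P \<mu> \<or> eventually (\<lambda>n. \<not> P n) \<mu>"
    using assms by (auto simp: nonprincipal_ultrafilter_def)
  have "Limsup \<mu> f \<le> Liminf \<mu> f"
  proof (rule dense_le)
    fix c assume c: "c < Limsup \<mu> f"
    have "\<not> eventually (\<lambda>n. f n \<le> c) \<mu>"
      using c Limsup_bounded[of f c \<mu>] by auto
    then have "eventually (\<lambda>n. \<not> f n \<le> c) \<mu>"
      using u by blast
    then have "eventually (\<lambda>n. c \<le> f n) \<mu>"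
      by (rule eventually_mono) auto
    then show "c \<le> Liminf \<mu> f"
      by (rule Liminf_bounded)
  qed
  then have "Liminf \<mu> f = Limsup \<mu> f"
    using Liminf_le_Limsup[OF nb] by (rule antisym[rotated])
  then have "(f \<longlongrightarrow> Limsup \<mu> f) \<mu>"
    using tendsto_iff_Liminf_eq_Limsup[OF nb] by blast
  then show ?thesis
    using tendsto_Lim[OF nb, of f "Limsup \<mu> f"] by simp
qed

context
  fixes \<mu> :: "nat filter" and X :: "'a metric" and \<alpha> :: "nat \<Rightarrow> real"
  assumes \<mu>: "nonprincipal_ultrafilter \<mu>"
    and \<alpha>: "\<And>n. 0 < \<alpha> n"
begin

lemma lim_dist_tendsto:
  "((\<lambda>n. ennreal (mdist X (x n) (y n) / \<alpha> n)) \<longlongrightarrow> lim_dist \<mu> X \<alpha> x y) \<mu>"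
  unfolding lim_dist_def by (rule ultrafilter_tendsto_Lim[OF \<mu>])

lemma lim_dist_commute: "lim_dist \<mu> X \<alpha> x y = lim_dist \<mu> X \<alpha> y x"
  by (simp add: lim_dist_def mdist_commute)

lemma lim_dist_refl: "range x \<subseteq> mspace X \<Longrightarrow> lim_dist \<mu> X \<alpha> x x = 0"
proof -
  assume "range x \<subseteq> mspace X"
  then have "mdist X (x n) (x n) = 0" for n
    using mdist_zero[of "x n" X "x n"] by blast
  then show ?thesis
    using \<mu> tendsto_Lim[OF _ tendsto_const, of \<mu> "0::ennreal"]
    by (simp add: lim_dist_def nonprincipal_ultrafilter_def)
qed

lemma lim_dist_triangle:
  assumes "range x \<subseteq> mspace X" "range y \<subseteq> mspace X" "range z \<subseteq> mspace X"
  shows "lim_dist \<mu> X \<alpha> x z \<le> lim_dist \<mu> X \<alpha> x y + lim_dist \<mu> X \<alpha> y z"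
proof (rule tendsto_le[OF _ tendsto_add[OF lim_dist_tendsto lim_dist_tendsto] lim_dist_tendsto])
  show "\<mu> \<noteq> bot"
    using \<mu> by (simp add: nonprincipal_ultrafilter_def)
  have "ennreal (mdist X (x n) (z n) / \<alpha> n)
      \<le> ennreal (mdist X (x n) (y n) / \<alpha> n) + ennreal (mdist X (y n) (z n) / \<alpha> n)" for n
  proof -
    have "mdist X (x n) (z n) \<le> mdist X (x n) (y n) + mdist X (y n) (z n)"
      using assms by (intro mdist_triangle) auto
    then have "mdist X (x n) (z n) / \<alpha> n \<le> mdist X (x n) (y n) / \<alpha> n + mdist X (y n) (z n) / \<alpha> n"
      using \<alpha>[of n] by (simp add: divide_right_mono flip: add_divide_distrib)
    then show ?thesis
      using \<alpha>[of n] by (subst ennreal_plus[symmetric]) (auto intro!: ennreal_leI simp: less_imp_le simp del: ennreal_plus)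
  qed
  then show "\<forall>\<^sub>F n in \<mu>. ennreal (mdist X (x n) (z n) / \<alpha> n)
      \<le> ennreal (mdist X (x n) (y n) / \<alpha> n) + ennreal (mdist X (y n) (z n) / \<alpha> n)"
    by simp
qed

context
  fixes e :: "nat \<Rightarrow> 'a"
  assumes e: "range e \<subseteq> mspace X"
begin

lemma equiv_cone_rel: "equiv (admissible \<mu> X e \<alpha>) (cone_rel \<mu> X e \<alpha>)"
proof (rule equivI)
  show "cone_rel \<mu> X e \<alpha> \<subseteq> admissible \<mu> X e \<alpha> \<times> admissible \<mu> X e \<alpha>"
    by (auto simp: cone_rel_def)
  show "refl_on (admissible \<mu> X e \<alpha>) (cone_rel \<mu> X e \<alpha>)"
    by (auto simp: refl_on_def cone_rel_def admissible_def lim_dist_refl)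
  show "sym (cone_rel \<mu> X e \<alpha>)"
    by (auto simp: sym_def cone_rel_def lim_dist_commute)
  show "trans (cone_rel \<mu> X e \<alpha>)"
  proof (rule transI)
    fix x y z assume *: "(x, y) \<in> cone_rel \<mu> X e \<alpha>" "(y, z) \<in> cone_rel \<mu> X e \<alpha>"
    then have "lim_dist \<mu> X \<alpha> x z \<le> 0"
      using lim_dist_triangle[of x y z] by (auto simp: cone_rel_def admissible_def)
    with * show "(x, z) \<in> cone_rel \<mu> X e \<alpha>"
      by (auto simp: cone_rel_def)
  qed
qed

lemma lim_dist_finite:
  assumes "x \<in> admissible \<mu> X e \<alpha>" "y \<in> admissible \<mu> X e \<alpha>"
  shows "lim_dist \<mu> X \<alpha> x y < \<infinity>"
proof -
  have "lim_dist \<mu> X \<alpha> x y \<le> lim_dist \<mu> X \<alpha> x e + lim_dist \<mu> X \<alpha> y e"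
    using assms e lim_dist_triangle[of x e y] lim_dist_commute[of e y]
    by (auto simp: admissible_def)
  also have "\<dots> < \<infinity>"
    using assms by (auto simp: admissible_def)
  finally show ?thesis .
qed

lemma lim_dist_cong:
  assumes "(x, x') \<in> cone_rel \<mu> X e \<alpha>" "(y, y') \<in> cone_rel \<mu> X e \<alpha>"
  shows "lim_dist \<mu> X \<alpha> x y = lim_dist \<mu> X \<alpha> x' y'"
proof -
  have le: "lim_dist \<mu> X \<alpha> a b \<le> lim_dist \<mu> X \<alpha> a' b'"
    if "(a, a') \<in> cone_rel \<mu> X e \<alpha>" "(b, b') \<in> cone_rel \<mu> X e \<alpha>" for a a' b b'
  proof -
    have r: "range a \<subseteq> mspace X" "range a' \<subseteq> mspace X" "range b \<subseteq> mspace X" "range b' \<subseteq> mspace X"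
      and z: "lim_dist \<mu> X \<alpha> a a' = 0" "lim_dist \<mu> X \<alpha> b' b = 0"
      using that lim_dist_commute[of b b'] by (auto simp: cone_rel_def admissible_def)
    have "lim_dist \<mu> X \<alpha> a b \<le> lim_dist \<mu> X \<alpha> a a' + lim_dist \<mu> X \<alpha> a' b"
      using r by (intro lim_dist_triangle)
    also have "\<dots> \<le> lim_dist \<mu> X \<alpha> a a' + (lim_dist \<mu> X \<alpha> a' b' + lim_dist \<mu> X \<alpha> b' b)"
      using r by (intro add_left_mono lim_dist_triangle)
    finally show ?thesis
      using z by simp
  qed
  have "(x', x) \<in> cone_rel \<mu> X e \<alpha>" "(y', y) \<in> cone_rel \<mu> X e \<alpha>"
    using assms equivE[OF equiv_cone_rel] by (meson symD)+
  then show ?thesis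
    using le assms by (intro antisym) blast+
qed

lemma some_in_class:
  assumes "x \<in> admissible \<mu> X e \<alpha>"
  shows "(x, SOME z. z \<in> cone_rel \<mu> X e \<alpha> `` {x}) \<in> cone_rel \<mu> X e \<alpha>"
proof -
  have "x \<in> cone_rel \<mu> X e \<alpha> `` {x}"
    by (rule equiv_class_self[OF equiv_cone_rel assms])
  then have "(SOME z. z \<in> cone_rel \<mu> X e \<alpha> `` {x}) \<in> cone_rel \<mu> X e \<alpha> `` {x}"
    by (rule someI[where P = "\<lambda>z. z \<in> cone_rel \<mu> X e \<alpha> `` {x}"])
  then show ?thesis
    by (rule ImageE) simp
qed

lemma Metric_space_Cone:
  "Metric_space (admissible \<mu> X e \<alpha> // cone_rel \<mu> X e \<alpha>)
     (\<lambda>C D. enn2real (lim_dist \<mu> X \<alpha> (SOME x. x \<in> C) (SOME y. y \<in> D)))"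
proof
  let ?s = "\<lambda>C. SOME x. x \<in> C"
  have s: "?s C \<in> admissible \<mu> X e \<alpha> \<and> C = cone_rel \<mu> X e \<alpha> `` {?s C}"
    if "C \<in> admissible \<mu> X e \<alpha> // cone_rel \<mu> X e \<alpha>" for C
  proof -
    from that obtain x where x: "x \<in> admissible \<mu> X e \<alpha>" "C = cone_rel \<mu> X e \<alpha> `` {x}"
      by (auto elim: quotientE)
    then have "(x, ?s C) \<in> cone_rel \<mu> X e \<alpha>"
      using some_in_class by simp
    moreover from this have "?s C \<in> admissible \<mu> X e \<alpha>"
      by (simp add: cone_rel_def)
    ultimately show ?thesis
      using x(2) equiv_class_eq[OF equiv_cone_rel] by metis
  qed
  fix C D E :: "(nat \<Rightarrow> 'a) set"
  show "0 \<le> enn2real (lim_dist \<mu> X \<alpha> (?s C) (?s D))"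
    by simp
  show "enn2real (lim_dist \<mu> X \<alpha> (?s C) (?s D)) = enn2real (lim_dist \<mu> X \<alpha> (?s D) (?s C))"
    by (simp add: lim_dist_commute)
  assume C: "C \<in> admissible \<mu> X e \<alpha> // cone_rel \<mu> X e \<alpha>"
    and D: "D \<in> admissible \<mu> X e \<alpha> // cone_rel \<mu> X e \<alpha>"
  have fin: "lim_dist \<mu> X \<alpha> (?s C) (?s D) < \<infinity>"
    using s[OF C] s[OF D] lim_dist_finite by blast
  show "enn2real (lim_dist \<mu> X \<alpha> (?s C) (?s D)) = 0 \<longleftrightarrow> C = D"
  proof
    assume "enn2real (lim_dist \<mu> X \<alpha> (?s C) (?s D)) = 0"
    then have "(?s C, ?s D) \<in> cone_rel \<mu> X e \<alpha>"
      using fin s[OF C] s[OF D] by (auto simp: cone_rel_def enn2real_eq_0_iff)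
    then show "C = D"
      using s[OF C] s[OF D] equiv_class_eq[OF equiv_cone_rel] by metis
  next
    assume "C = D"
    then show "enn2real (lim_dist \<mu> X \<alpha> (?s C) (?s D)) = 0"
      using s[OF C] lim_dist_refl[of "?s C"] unfolding admissible_def by (metis (lifting) enn2real_0 mem_Collect_eq)
  qed
  assume E: "E \<in> admissible \<mu> X e \<alpha> // cone_rel \<mu> X e \<alpha>"
  have "lim_dist \<mu> X \<alpha> (?s C) (?s E) \<le> lim_dist \<mu> X \<alpha> (?s C) (?s D) + lim_dist \<mu> X \<alpha> (?s D) (?s E)"
    using s[OF C] s[OF D] s[OF E] by (intro lim_dist_triangle) (auto simp: admissible_def)
  moreover have "lim_dist \<mu> X \<alpha> (?s D) (?s E) < \<infinity>"
    using s[OF D] s[OF E] lim_dist_finite by blast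
  ultimately show "enn2real (lim_dist \<mu> X \<alpha> (?s C) (?s E))
      \<le> enn2real (lim_dist \<mu> X \<alpha> (?s C) (?s D)) + enn2real (lim_dist \<mu> X \<alpha> (?s D) (?s E))"
    using fin by (simp add: enn2real_mono flip: enn2real_plus)
qed

lemma mspace_Cone: "mspace (Cone \<mu> X e \<alpha>) = admissible \<mu> X e \<alpha> // cone_rel \<mu> X e \<alpha>"
  by (simp add: Cone_def mspace_def metric_inverse Metric_space_Cone)

lemma mdist_Cone:
  assumes "x \<in> admissible \<mu> X e \<alpha>" "y \<in> admissible \<mu> X e \<alpha>"
  shows "mdist (Cone \<mu> X e \<alpha>) (cone_rel \<mu> X e \<alpha> `` {x}) (cone_rel \<mu> X e \<alpha> `` {y}) =
           enn2real (lim_dist \<mu> X \<alpha> x y)"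
proof -
  have "mdist (Cone \<mu> X e \<alpha>) = (\<lambda>C D. enn2real (lim_dist \<mu> X \<alpha> (SOME x. x \<in> C) (SOME y. y \<in> D)))"
    by (simp add: Cone_def mdist_def metric_inverse Metric_space_Cone)
  then show ?thesis
    using lim_dist_cong[OF some_in_class some_in_class, OF assms] by simp
qed

end
end

lemma inj_on_name:
  fixes X :: "'a point metric"
  assumes "nonprincipal_ultrafilter \<mu>" "\<And>n. 0 < \<alpha> n" "range e \<subseteq> mspace X"
  shows "inj_on name (mspace (Cone \<mu> X e \<alpha>))"
proof (rule inj_onI)
  fix C D assume C: "C \<in> mspace (Cone \<mu> X e \<alpha>)" and D: "D \<in> mspace (Cone \<mu> X e \<alpha>)"
    and eq: "name C = name D"
  have eqv: "equiv (admissible \<mu> X e \<alpha>) (cone_rel \<mu> X e \<alpha>)"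
    using assms by (rule equiv_cone_rel)
  have msp: "mspace (Cone \<mu> X e \<alpha>) = admissible \<mu> X e \<alpha> // cone_rel \<mu> X e \<alpha>"
    using assms by (rule mspace_Cone)
  have mem: "(SOME x. x \<in> B) \<in> B" if "B \<in> mspace (Cone \<mu> X e \<alpha>)" for B
    using that in_quotient_imp_non_empty[OF eqv] by (simp add: msp some_in_eq)
  have "C \<inter> D \<noteq> {}"
    using mem[OF C] mem[OF D] eq by (auto simp: name_def)
  then show "C = D"
    using quotient_disj[OF eqv, of C D] C D unfolding msp by argo
qed

lemma Metric_space_relabel:
  assumes "inj_on f (mspace X)"
  shows "Metric_space (f ` mspace X)
           (\<lambda>p q. mdist X (inv_into (mspace X) f p) (inv_into (mspace X) f q))"
  using assms by unfold_locales (auto simp: mdist_commute inj_on_eq_iff intro: mdist_triangle)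

lemma mspace_relabel: "inj_on f (mspace X) \<Longrightarrow> mspace (relabel f X) = f ` mspace X"
  by (simp add: relabel_def mspace_def metric_inverse Metric_space_relabel[unfolded mspace_def])

lemma mdist_relabel:
  assumes "inj_on f (mspace X)" "x \<in> mspace X" "y \<in> mspace X"
  shows "mdist (relabel f X) (f x) (f y) = mdist X x y"
proof -
  have "mdist (relabel f X) = (\<lambda>p q. mdist X (inv_into (mspace X) f p) (inv_into (mspace X) f q))"
    using Metric_space_relabel[OF assms(1)]
    by (simp add: relabel_def mdist_def[of "metric _"] metric_inverse)
  then show ?thesis
    using assms by simp
qed

end

theory Submission
  imports Defs
begin

text \<open>
  The space is a countable union of finite pieces, one for each nonempty finite set \<open>F\<close> of naturals with
  \<open>|F| \<le> min F\<close>. The piece of \<open>F\<close> sits at distance \<open>r\<^sub>F = (\<Prod>n\<in>F. \<alpha>\<^sub>n)\<close> from the base point, where \<open>\<alpha>\<close> grows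
  very fast, and is a copy, rescaled by \<open>r\<^sub>F\<close>, of \<open>|F|\<close> convergent sequences truncated at length \<open>min F\<close>.
  Rescaling by \<open>\<alpha>\<^sub>n\<close> with \<open>n \<rightarrow> \<infinity>\<close> leaves visible exactly the pieces of the sets \<open>{n} \<union> F\<close>, which turn into
  pieces indexed by \<open>F\<close> with one more sequence each; the piece of \<open>F = {}\<close> is no longer truncated. Hence the
  \<open>i\<close>-th iterated cone has exactly \<open>i\<close> non-isolated points, the limits of the \<open>i\<close> full sequences.

  For an arbitrary cone, if no radius \<open>r\<^sub>F\<close> is comparable to the scale, or if the base point escapes, the cone
  is finite because the sequences are sparse. Otherwise the comparable sets have the form \<open>H\<^sub>n \<union> F\<close> with
  \<open>min H\<^sub>n \<rightarrow> \<infinity>\<close> and \<open>F\<close> fixed, and the cone is determined up to scaling by the limit of \<open>|H\<^sub>n|\<close> in \<open>\<nat> \<union> {\<infinity>}\<close>.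
\<close>

section \<open>Ultrafilter limits\<close>

locale nonprincipal =
  fixes \<mu> :: "nat filter"
  assumes ultra: "nonprincipal_ultrafilter \<mu>"
begin

lemma not_bot [simp]: "\<mu> \<noteq> bot"
  using ultra by (simp add: nonprincipal_ultrafilter_def)

lemma eventually_not_iff: "eventually (\<lambda>n. \<not> P n) \<mu> \<longleftrightarrow> \<not> eventually P \<mu>"
proof
  assume "eventually (\<lambda>n. \<not> P n) \<mu>"
  then show "\<not> eventually P \<mu>"
    using eventually_conj[of P \<mu> "\<lambda>n. \<not> P n"] by auto
next
  assume "\<not> eventually P \<mu>"
  then show "eventually (\<lambda>n. \<not> P n) \<mu>"
    using ultra unfolding nonprincipal_ultrafilter_def by blast
qed

lemma eventually_disj_iff: "eventually (\<lambda>n. P n \<or> Q n) \<mu> \<longleftrightarrow> eventually P \<mu> \<or> eventually Q \<mu>"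
proof
  assume a: "eventually (\<lambda>n. P n \<or> Q n) \<mu>"
  show "eventually P \<mu> \<or> eventually Q \<mu>"
  proof (rule ccontr)
    assume "\<not> (eventually P \<mu> \<or> eventually Q \<mu>)"
    then have "eventually (\<lambda>n. \<not> P n) \<mu>" "eventually (\<lambda>n. \<not> Q n) \<mu>"
      by (auto simp: eventually_not_iff)
    with a have "eventually (\<lambda>n. False) \<mu>"
      by eventually_elim auto
    then show False by simp
  qed
qed (auto elim: eventually_mono)

text \<open>Pigeonhole along the ultrafilter: data with finitely many possible values can be frozen
  to a single one.\<close>

lemma eventually_bex_finite:
  assumes "finite A" "eventually (\<lambda>n. \<exists>a\<in>A. P a n) \<mu>"
  shows "\<exists>a\<in>A. eventually (P a) \<mu>"
  using assms by (induction A) (auto simp: eventually_disj_iff)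

text \<open>If \<open>{m}\<close> belonged to \<open>\<mu>\<close>, then \<open>\<mu>\<close> would
  be principal at \<open>m\<close>; so singletons, and hence initial segments, can be
  discarded.\<close>

lemma eventually_ge: "eventually (\<lambda>n. k \<le> n) \<mu>"
proof -
  have ne: "eventually (\<lambda>n. n \<noteq> m) \<mu>" for m
  proof (rule ccontr)
    assume "\<not> ?thesis"
    then have m: "eventually (\<lambda>n. n = m) \<mu>"
      by (simp add: eventually_not_iff)
    have "\<mu> = principal {m}"
    proof (rule filter_eqI, rule iffI)
      fix P assume "eventually P \<mu>"
      with m have "eventually (\<lambda>n. P m) \<mu>"
        by eventually_elim auto
      then show "eventually P (principal {m})"
        by (simp add: eventually_principal)
    next
      fix P assume "eventually P (principal {m})"
      with m show "eventually P \<mu>"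
        by (auto simp: eventually_principal elim: eventually_mono)
    qed
    then show False
      using ultra by (simp add: nonprincipal_ultrafilter_def)
  qed
  have "eventually (\<lambda>n. \<forall>m\<in>{..<k}. n \<noteq> m) \<mu>"
    using ne by (intro eventually_ball_finite) auto
  then show ?thesis
    by eventually_elim (metis lessThan_iff not_less)
qed

text \<open>Compactness: the limit already exists in \<open>[0, \<infinity>]\<close>, and the bound
  keeps it finite.\<close>

lemma bounded_has_limit:
  fixes f :: "nat \<Rightarrow> real"
  assumes "\<And>n. 0 \<le> f n" "eventually (\<lambda>n. f n \<le> K) \<mu>"
  shows "\<exists>l\<ge>0. (f \<longlongrightarrow> l) \<mu>"
proof -
  let ?L = "Lim \<mu> (\<lambda>n. ennreal (f n))"
  have t: "((\<lambda>n. ennreal (f n)) \<longlongrightarrow> ?L) \<mu>"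
    by (rule ultrafilter_tendsto_Lim[OF ultra])
  have "?L \<le> ennreal K"
    using assms(2) by (intro tendsto_upperbound[OF t]) (auto elim!: eventually_mono intro: ennreal_leI)
  then have "?L < top"
    using le_less_trans[OF _ ennreal_less_top] by blast
  then obtain l where "?L = ennreal l" "0 \<le> l"
    by (metis ennreal_cases order_less_irrefl infinity_ennreal_def)
  then show ?thesis
    using t assms(1) by (auto simp: tendsto_ennreal_iff)
qed

text \<open>This alternative will separate sequences that merge with the origin from those that stay
  visible at the given scale.\<close>

lemma tendsto_0_or_bounded_below:
  fixes f :: "nat \<Rightarrow> real"
  assumes "\<And>n. 0 \<le> f n"
  shows "(f \<longlongrightarrow> 0) \<mu> \<or> (\<exists>c>0. eventually (\<lambda>n. c \<le> f n) \<mu>)"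
proof (rule disjCI)
  assume "\<not> (\<exists>c>0. eventually (\<lambda>n. c \<le> f n) \<mu>)"
  then have "eventually (\<lambda>n. f n < c) \<mu>" if "c > 0" for c
    using that eventually_not_iff[of "\<lambda>n. c \<le> f n"] by (auto simp: not_le)
  then show "(f \<longlongrightarrow> 0) \<mu>"
    using assms by (intro order_tendstoI) (auto intro: less_le_trans always_eventually)
qed

end

section \<open>Cones of parametrized metric spaces\<close>

text \<open>The type of points changes with each cone. Carrying distances on a parameter set allows
  all cones to be compared with one family of model spaces. The map \<open>g\<close> may identify
  parameters at \<open>D\<close>-distance 0.\<close>

definition param :: "'a metric \<Rightarrow> 'p set \<Rightarrow> ('p \<Rightarrow> 'p \<Rightarrow> real) \<Rightarrow> ('p \<Rightarrow> 'a) \<Rightarrow> bool" where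
  "param Y P D g \<longleftrightarrow> g ` P = mspace Y \<and> (\<forall>p\<in>P. \<forall>q\<in>P. mdist Y (g p) (g q) = D p q)"

lemma param_mem: "param Y P D g \<Longrightarrow> p \<in> P \<Longrightarrow> g p \<in> mspace Y"
  by (auto simp: param_def)

lemma param_mdist: "param Y P D g \<Longrightarrow> p \<in> P \<Longrightarrow> q \<in> P \<Longrightarrow> mdist Y (g p) (g q) = D p q"
  by (auto simp: param_def)

lemma param_eq_iff:
  assumes "param Y P D g" "p \<in> P" "q \<in> P"
  shows "g p = g q \<longleftrightarrow> D p q = 0"
  using mdist_zero[OF param_mem[OF assms(1,2)] param_mem[OF assms(1,3)]] param_mdist[OF assms] by simp

lemma param_relabel:
  assumes "param Y P D g" "inj_on f (mspace Y)"
  shows "param (relabel f Y) P D (f \<circ> g)"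
proof -
  have "g ` P = mspace Y"
    using assms(1) by (simp add: param_def)
  then show ?thesis
    unfolding param_def image_comp[symmetric]
    by (auto simp: mspace_relabel[OF assms(2)] mdist_relabel[OF assms(2)] param_mem[OF assms(1)]
        param_mdist[OF assms(1)])
qed

text \<open>Sending \<open>g p\<close> to \<open>h p\<close> multiplies distances by
  \<open>b / a\<close>, so this map and its inverse are Lipschitz.\<close>

lemma param_homeomorphic:
  assumes Y: "param Y P (\<lambda>p q. a * D p q) g" and Z: "param Z P (\<lambda>p q. b * D p q) h"
    and "a > 0" "b > 0"
  shows "mtopology_of Y homeomorphic_space mtopology_of Z"
proof -
  \<comment> \<open>The chosen parameter does not matter: parameters with the same image are at
    \<open>D\<close>-distance 0, hence have the same image under the other map too.\<close>
  define f where "f = (\<lambda>y. h (SOME p. p \<in> P \<and> g p = y))"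
  define f' where "f' = (\<lambda>z. g (SOME p. p \<in> P \<and> h p = z))"
  have f: "f (g p) = h p" if "p \<in> P" for p
  proof -
    have "(SOME q. q \<in> P \<and> g q = g p) \<in> P \<and> g (SOME q. q \<in> P \<and> g q = g p) = g p"
      by (rule someI[of _ p]) (use that in auto)
    then show ?thesis
      using that assms param_eq_iff[OF Y] param_eq_iff[OF Z] unfolding f_def
      by (metis (no_types, lifting) mult_eq_0_iff less_irrefl)
  qed
  have f': "f' (h p) = g p" if "p \<in> P" for p
  proof -
    have "(SOME q. q \<in> P \<and> h q = h p) \<in> P \<and> h (SOME q. q \<in> P \<and> h q = h p) = h p"
      by (rule someI[of _ p]) (use that in auto)
    then show ?thesis
      using that assms param_eq_iff[OF Y] param_eq_iff[OF Z] unfolding f'_def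
      by (metis (no_types, lifting) mult_eq_0_iff less_irrefl)
  qed
  have sY: "mspace Y = g ` P" and sZ: "mspace Z = h ` P"
    using Y Z by (auto simp: param_def)
  have "Lipschitz_continuous_map Y Z f"
    unfolding Lipschitz_continuous_map_def
  proof (intro conjI exI[of _ "b / a"] ballI)
    fix x y assume "x \<in> mspace Y" "y \<in> mspace Y"
    then show "mdist Z (f x) (f y) \<le> b / a * mdist Y x y"
      using \<open>a > 0\<close> by (auto simp: sY f param_mdist[OF Y] param_mdist[OF Z])
  qed (auto simp: sY sZ f)
  moreover have "Lipschitz_continuous_map Z Y f'"
    unfolding Lipschitz_continuous_map_def
  proof (intro conjI exI[of _ "a / b"] ballI)
    fix x y assume "x \<in> mspace Z" "y \<in> mspace Z"
    then show "mdist Y (f' x) (f' y) \<le> a / b * mdist Z x y"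
      using \<open>b > 0\<close> by (auto simp: sZ f' param_mdist[OF Y] param_mdist[OF Z])
  qed (auto simp: sY sZ f')
  ultimately have "homeomorphic_maps (mtopology_of Y) (mtopology_of Z) f f'"
    unfolding homeomorphic_maps_def
    by (auto simp: Lipschitz_continuous_imp_continuous_map sY sZ f f')
  then show ?thesis
    by (auto simp: homeomorphic_space_def)
qed

locale cone_data = nonprincipal +
  fixes Y :: "'a metric" and P :: "'p set" and D :: "'p \<Rightarrow> 'p \<Rightarrow> real" and g :: "'p \<Rightarrow> 'a"
    and b :: "nat \<Rightarrow> 'p" and \<beta> :: "nat \<Rightarrow> real"
  assumes param: "param Y P D g" and base: "\<And>n. b n \<in> P" and scale_pos: "\<And>n. 0 < \<beta> n"
begin

lemma D_nonneg: "p \<in> P \<Longrightarrow> q \<in> P \<Longrightarrow> 0 \<le> D p q"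
  by (metis mdist_nonneg param param_mdist)

definition bounded_seqs :: "(nat \<Rightarrow> 'p) set" where
  "bounded_seqs = {p. range p \<subseteq> P \<and> (\<exists>K. eventually (\<lambda>n. D (p n) (b n) \<le> K * \<beta> n) \<mu>)}"

lemma range_base: "range (\<lambda>n. g (b n)) \<subseteq> mspace Y"
  using base param_mem[OF param] by auto

lemma lim_dist_eq:
  assumes "range p \<subseteq> P" "range q \<subseteq> P" "((\<lambda>n. D (p n) (q n) / \<beta> n) \<longlongrightarrow> l) \<mu>"
  shows "lim_dist \<mu> Y \<beta> (\<lambda>n. g (p n)) (\<lambda>n. g (q n)) = ennreal l"
proof -
  have "mdist Y (g (p n)) (g (q n)) = D (p n) (q n)" for n
    using assms by (simp add: param_mdist[OF param] range_subsetD)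
  then show ?thesis
    unfolding lim_dist_def using assms(3) by (intro tendsto_Lim) (auto intro: tendsto_ennrealI)
qed

lemma lim_dist_finite_iff:
  assumes "range p \<subseteq> P" "range q \<subseteq> P"
  shows "lim_dist \<mu> Y \<beta> (\<lambda>n. g (p n)) (\<lambda>n. g (q n)) < \<infinity> \<longleftrightarrow>
     (\<exists>K. eventually (\<lambda>n. D (p n) (q n) \<le> K * \<beta> n) \<mu>)"
proof
  have eq: "mdist Y (g (p n)) (g (q n)) = D (p n) (q n)" for n
    using assms by (simp add: param_mdist[OF param] range_subsetD)
  assume "lim_dist \<mu> Y \<beta> (\<lambda>n. g (p n)) (\<lambda>n. g (q n)) < \<infinity>"
  \<comment> \<open>A number strictly between the limit and \<open>\<infinity>\<close> turns
    convergence into an eventual bound.\<close>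
  then obtain c where c: "lim_dist \<mu> Y \<beta> (\<lambda>n. g (p n)) (\<lambda>n. g (q n)) < c" "c < top"
    using dense by (auto simp: infinity_ennreal_def)
  then obtain K where K: "lim_dist \<mu> Y \<beta> (\<lambda>n. g (p n)) (\<lambda>n. g (q n)) < ennreal K" "0 \<le> K"
    by (cases c) auto
  have "eventually (\<lambda>n. ennreal (mdist Y (g (p n)) (g (q n)) / \<beta> n) < ennreal K) \<mu>"
    by (rule order_tendstoD(2)[OF lim_dist_tendsto[OF ultra scale_pos] K(1)])
  then have "eventually (\<lambda>n. D (p n) (q n) \<le> K * \<beta> n) \<mu>"
  proof eventually_elim
    case (elim n)
    then have "\<not> ennreal K \<le> ennreal (D (p n) (q n) / \<beta> n)"
      by (simp add: eq not_le)
    then have "\<not> K \<le> D (p n) (q n) / \<beta> n"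
      using ennreal_leI by blast
    then show ?case
      using scale_pos[of n] by (simp add: pos_divide_less_eq not_le)
  qed
  then show "\<exists>K. eventually (\<lambda>n. D (p n) (q n) \<le> K * \<beta> n) \<mu>" ..
next
  assume "\<exists>K. eventually (\<lambda>n. D (p n) (q n) \<le> K * \<beta> n) \<mu>"
  then obtain K where "eventually (\<lambda>n. D (p n) (q n) \<le> K * \<beta> n) \<mu>" ..
  then have "eventually (\<lambda>n. D (p n) (q n) / \<beta> n \<le> K) \<mu>"
    by eventually_elim (simp add: pos_divide_le_eq scale_pos)
  moreover have "0 \<le> D (p n) (q n) / \<beta> n" for n
    using assms scale_pos[of n] D_nonneg[of "p n" "q n"] by (auto intro!: divide_nonneg_pos)
  ultimately obtain l where "((\<lambda>n. D (p n) (q n) / \<beta> n) \<longlongrightarrow> l) \<mu>"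
    using bounded_has_limit[of "\<lambda>n. D (p n) (q n) / \<beta> n" K] by auto
  then show "lim_dist \<mu> Y \<beta> (\<lambda>n. g (p n)) (\<lambda>n. g (q n)) < \<infinity>"
    using lim_dist_eq[OF assms] by simp
qed

lemma admissible_eq:
  "admissible \<mu> Y (\<lambda>n. g (b n)) \<beta> = (\<lambda>p n. g (p n)) ` bounded_seqs"
proof (intro equalityI subsetI)
  fix x assume x: "x \<in> admissible \<mu> Y (\<lambda>n. g (b n)) \<beta>"
  then have "x n \<in> g ` P" for n
    using param by (auto simp: admissible_def param_def image_subset_iff)
  then have "\<exists>q\<in>P. x n = g q" for n
    by blast
  then obtain p where p: "\<And>n. p n \<in> P" "x = (\<lambda>n. g (p n))"
    by metis
  then have "p \<in> bounded_seqs"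
    using x lim_dist_finite_iff[of p b] base by (auto simp: admissible_def bounded_seqs_def image_subset_iff)
  then show "x \<in> (\<lambda>p n. g (p n)) ` bounded_seqs"
    using p by auto
next
  fix x assume "x \<in> (\<lambda>p n. g (p n)) ` bounded_seqs"
  then obtain p where p: "p \<in> bounded_seqs" "x = (\<lambda>n. g (p n))" by auto
  then show "x \<in> admissible \<mu> Y (\<lambda>n. g (b n)) \<beta>"
    using lim_dist_finite_iff[of p b] base param_mem[OF param]
    by (auto simp: admissible_def bounded_seqs_def image_subset_iff)
qed

definition cls :: "(nat \<Rightarrow> 'p) \<Rightarrow> (nat \<Rightarrow> 'a) set" where
  "cls p = cone_rel \<mu> Y (\<lambda>n. g (b n)) \<beta> `` {\<lambda>n. g (p n)}"

lemma mspace_Cone_eq: "mspace (Cone \<mu> Y (\<lambda>n. g (b n)) \<beta>) = cls ` bounded_seqs"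
  using mspace_Cone[OF ultra scale_pos range_base]
  by (auto simp: admissible_eq quotient_def cls_def)

lemma cls_eqI:
  assumes "p \<in> bounded_seqs" "q \<in> bounded_seqs" "((\<lambda>n. D (p n) (q n) / \<beta> n) \<longlongrightarrow> 0) \<mu>"
  shows "cls p = cls q"
proof -
  have "lim_dist \<mu> Y \<beta> (\<lambda>n. g (p n)) (\<lambda>n. g (q n)) = 0"
    using lim_dist_eq[of p q 0] assms by (auto simp: bounded_seqs_def)
  then have "((\<lambda>n. g (p n)), (\<lambda>n. g (q n))) \<in> cone_rel \<mu> Y (\<lambda>n. g (b n)) \<beta>"
    using assms by (auto simp: cone_rel_def admissible_eq)
  then show ?thesis
    unfolding cls_def by (intro equiv_class_eq[OF equiv_cone_rel[OF ultra scale_pos range_base]])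
qed

lemma mdist_cls:
  assumes "p \<in> bounded_seqs" "q \<in> bounded_seqs" "((\<lambda>n. D (p n) (q n) / \<beta> n) \<longlongrightarrow> l) \<mu>"
  shows "mdist (Cone \<mu> Y (\<lambda>n. g (b n)) \<beta>) (cls p) (cls q) = l"
proof -
  have r: "range p \<subseteq> P" "range q \<subseteq> P"
    using assms by (auto simp: bounded_seqs_def)
  have "0 \<le> l"
    using r scale_pos by (intro tendsto_lowerbound[OF assms(3)] always_eventually allI not_bot)
      (auto intro!: divide_nonneg_pos D_nonneg)
  then show ?thesis
    unfolding cls_def using assms
    by (subst mdist_Cone[OF ultra scale_pos range_base]) (auto simp: admissible_eq lim_dist_eq[OF r assms(3)])
qed

text \<open>The tool by which cones are identified: \<open>\<xi> q\<close> is a sequence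
  representing the point \<open>q\<close>, and the last hypothesis says that these representatives
  exhaust the cone.\<close>

lemma param_Cone:
  assumes "\<And>q. q \<in> Q \<Longrightarrow> \<xi> q \<in> bounded_seqs"
    and "\<And>q q'. q \<in> Q \<Longrightarrow> q' \<in> Q \<Longrightarrow> ((\<lambda>n. D (\<xi> q n) (\<xi> q' n) / \<beta> n) \<longlongrightarrow> D' q q') \<mu>"
    and "\<And>p. p \<in> bounded_seqs \<Longrightarrow> \<exists>q\<in>Q. ((\<lambda>n. D (p n) (\<xi> q n) / \<beta> n) \<longlongrightarrow> 0) \<mu>"
  shows "param (Cone \<mu> Y (\<lambda>n. g (b n)) \<beta>) Q D' (\<lambda>q. cls (\<xi> q))"
  unfolding param_def
proof (intro conjI ballI)
  show "(\<lambda>q. cls (\<xi> q)) ` Q = mspace (Cone \<mu> Y (\<lambda>n. g (b n)) \<beta>)"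
    unfolding mspace_Cone_eq using assms(1,3) cls_eqI by (auto simp: image_iff) metis
qed (use assms mdist_cls in auto)

end

section \<open>Finiteness by counting classes, and the topology of finite metric spaces\<close>

lemma finite_quotient_of_three:
  assumes "equiv A r" "\<And>x y z. x \<in> A \<Longrightarrow> y \<in> A \<Longrightarrow> z \<in> A \<Longrightarrow> (x, y) \<in> r \<or> (y, z) \<in> r \<or> (x, z) \<in> r"
  shows "finite (A // r)"
proof (cases "\<exists>x\<in>A. \<exists>y\<in>A. (x, y) \<notin> r")
  case True
  then obtain x y where xy: "x \<in> A" "y \<in> A" "(x, y) \<notin> r" by auto
  have "A // r \<subseteq> {r `` {x}, r `` {y}}"
  proof
    fix C assume "C \<in> A // r"
    then obtain z where z: "z \<in> A" "C = r `` {z}" by (auto elim: quotientE)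
    then have "(x, z) \<in> r \<or> (y, z) \<in> r" using assms(2)[of x y z] xy by blast
    then show "C \<in> {r `` {x}, r `` {y}}"
      using z equiv_class_eq[OF assms(1)] by blast
  qed
  then show ?thesis by (rule finite_subset) auto
next
  case False
  have "A // r \<subseteq> {A}"
  proof
    fix C assume "C \<in> A // r"
    then obtain z where z: "z \<in> A" "C = r `` {z}" by (auto elim: quotientE)
    then have "C = A" using False equivE[OF assms(1)] by auto
    then show "C \<in> {A}" by simp
  qed
  then show ?thesis by (rule finite_subset) auto
qed

text \<open>Each relation has at most two classes, and the pair of classes determines the element.
  For escaping base points, \<open>r\<close> and \<open>s\<close> will compare first and second
  coordinates.\<close>

lemma finite_of_two_relations:
  assumes "equiv A r" "\<And>x y z. x \<in> A \<Longrightarrow> y \<in> A \<Longrightarrow> z \<in> A \<Longrightarrow> (x, y) \<in> r \<or> (y, z) \<in> r \<or> (x, z) \<in> r"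
    and "equiv A s" "\<And>x y z. x \<in> A \<Longrightarrow> y \<in> A \<Longrightarrow> z \<in> A \<Longrightarrow> (x, y) \<in> s \<or> (y, z) \<in> s \<or> (x, z) \<in> s"
    and "\<And>x y. (x, y) \<in> r \<Longrightarrow> (x, y) \<in> s \<Longrightarrow> x = y"
  shows "finite A"
proof (rule inj_on_finite)
  show "inj_on (\<lambda>x. (r `` {x}, s `` {x})) A"
    using assms(5) eq_equiv_class[OF _ assms(1)] eq_equiv_class[OF _ assms(3)]
    by (auto simp: inj_on_def)
  show "(\<lambda>x. (r `` {x}, s `` {x})) ` A \<subseteq> (A // r) \<times> (A // s)"
    by (auto intro: quotientI)
  show "finite ((A // r) \<times> (A // s))"
    using finite_quotient_of_three[of A r] finite_quotient_of_three[of A s] assms by blast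
qed

lemma mtopology_of_finite:
  assumes "finite (mspace X)"
  shows "mtopology_of X = discrete_topology (mspace X)"
proof (rule finite_topspace_imp_discrete_topology)
  show "Hausdorff_space (mtopology_of X)"
    unfolding mtopology_of_def by (rule Metric_space.Hausdorff_space_mtopology) simp
qed (use assms in auto)

lemma finite_homeomorphic:
  assumes "finite (mspace Y)" "finite (mspace Z)" "card (mspace Y) = card (mspace Z)"
  shows "mtopology_of Y homeomorphic_space mtopology_of Z"
proof -
  obtain f where f: "bij_betw f (mspace Y) (mspace Z)"
    using assms finite_same_card_bij by blast
  then have "homeomorphic_maps (mtopology_of Y) (mtopology_of Z) f (inv_into (mspace Y) f)"
    unfolding homeomorphic_maps_def using assms
    by (auto simp: mtopology_of_finite bij_betw_def inv_into_into f_inv_into_f)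
  then show ?thesis
    by (auto simp: homeomorphic_space_def)
qed

section \<open>The model spaces\<close>

text \<open>
  Any growth with \<open>n * wt 0 * \<dots> * wt (n - 1) \<le> wt n\<close> would do: products over two finite sets are then of
  comparable size only if the sets differ in bounded positions.
\<close>

definition wt :: "nat \<Rightarrow> real" where
  "wt n = 2 ^ (3 ^ n)"

lemma wt_ge_2: "2 \<le> wt n"
  unfolding wt_def using power_increasing[of 1 "3 ^ n" "2::real"] by simp

lemma wt_pos [simp]: "0 < wt n"
  by (simp add: wt_def)

lemma prod_wt_ge_1: "1 \<le> prod wt F"
proof (rule prod_ge_1)
  show "1 \<le> wt i" for i
    using wt_ge_2[of i] by simp
qed

lemma prod_wt_pos [simp]: "0 < prod wt F"
  using prod_wt_ge_1[of F] by simp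

lemma prod_wt_simps [simp]: "0 \<le> prod wt F" "\<not> prod wt F \<le> 0" "prod wt F \<noteq> 0"
  using prod_wt_pos[of F] by linarith+

lemma prod_wt_mono: "finite G \<Longrightarrow> F \<subseteq> G \<Longrightarrow> prod wt F \<le> prod wt G"
proof (rule prod_mono2)
  show "1 \<le> wt i" for i
    using wt_ge_2[of i] by simp
qed (auto intro: less_imp_le)

text \<open>The exponents satisfy \<open>2 * (3^0 + ... + 3^(n - 1)) = 3^n - 1\<close>. The square
  provides the spare factor that \<open>prod_wt_lex_less\<close> needs.\<close>

lemma prod_wt_lessThan_square_le: "(prod wt {..<n})\<^sup>2 \<le> wt n"
proof (induction n)
  case (Suc n)
  have "(prod wt {..<Suc n})\<^sup>2 = (prod wt {..<n})\<^sup>2 * (wt n)\<^sup>2"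
    by (simp add: power_mult_distrib)
  also have "\<dots> \<le> wt n * (wt n)\<^sup>2"
    using Suc by (intro mult_right_mono) auto
  also have "\<dots> = wt (Suc n)"
    by (simp add: wt_def power_mult power2_eq_square power3_eq_cube flip: power_mult power_add)
  finally show ?case .
qed (simp add: wt_def)

lemma le_prod_wt_lessThan: "real n \<le> prod wt {..<n}"
proof -
  have "real n \<le> 2 ^ n"
    by (rule less_imp_le[OF of_nat_less_two_power])
  also have "\<dots> = (\<Prod>i<n. 2)"
    by simp
  also have "\<dots> \<le> prod wt {..<n}"
    using wt_ge_2 by (intro prod_mono) auto
  finally show ?thesis .
qed

text \<open>The weight at \<open>j\<close> is at least the square of the product of all lower
  weights: one factor covers the part of \<open>G\<close> below \<open>j\<close>, and the other is
  at least \<open>j\<close>.\<close>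

lemma prod_wt_lex_less:
  assumes "finite F" "finite G" "j \<in> F" "j \<notin> G" "\<And>i. j < i \<Longrightarrow> i \<in> G \<Longrightarrow> i \<in> F"
  shows "real j * prod wt G \<le> prod wt F"
proof -
  let ?U = "{i\<in>F. j < i}"
  have "prod wt G \<le> prod wt ({..<j} \<union> ?U)"
  proof (rule prod_wt_mono)
    show "G \<subseteq> {..<j} \<union> ?U"
      using assms(4,5) by (auto, (metis linorder_neqE_nat)+)
  qed (use assms in auto)
  also have "\<dots> = prod wt {..<j} * prod wt ?U"
    using assms(1) by (intro prod.union_disjoint) auto
  finally have "real j * prod wt G \<le> prod wt {..<j} * (prod wt {..<j} * prod wt ?U)"
    by (intro mult_mono le_prod_wt_lessThan) (auto intro: prod_nonneg less_imp_le)
  also have "\<dots> = (prod wt {..<j})\<^sup>2 * prod wt ?U"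
    by (simp add: power2_eq_square)
  also have "\<dots> \<le> wt j * prod wt ?U"
    by (intro mult_right_mono prod_wt_lessThan_square_le) (simp add: less_imp_le)
  also have "\<dots> = prod wt (insert j ?U)"
    using assms(1) by simp
  also have "\<dots> \<le> prod wt F"
    using assms by (intro prod_wt_mono) auto
  finally show ?thesis .
qed

text \<open>The largest element of the symmetric difference lies in exactly one of the sets, and by
  \<open>prod_wt_lex_less\<close> it makes the product over that set larger by at least this
  factor.\<close>

lemma sym_diff_le_of_comparable:
  assumes "finite F" "finite G" "prod wt F \<le> C * prod wt G" "prod wt G \<le> C * prod wt F"
    and "j \<in> sym_diff F G"
  shows "real j \<le> C"
proof -
  define J where "J = Max (sym_diff F G)"
  have fin: "finite (sym_diff F G)"
    using assms by auto
  have J: "J \<in> sym_diff F G"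
    unfolding J_def using fin assms(5) by (intro Max_in) auto
  have "j \<le> J"
    unfolding J_def using fin assms(5) by (rule Max_ge)
  have above: "i \<in> F \<longleftrightarrow> i \<in> G" if "J < i" for i
    using that Max_ge[OF fin, of i] unfolding J_def by fastforce
  have "real J \<le> C"
  proof (cases "J \<in> F")
    case True
    then have "real J * prod wt G \<le> prod wt F"
      using assms J above by (intro prod_wt_lex_less) auto
    then have "real J * prod wt G \<le> C * prod wt G"
      using assms(3) by (rule order_trans)
    then show ?thesis
      by (rule mult_right_le_imp_le) simp
  next
    case False
    then have "real J * prod wt F \<le> prod wt G"
      using assms J above by (intro prod_wt_lex_less) auto
    then have "real J * prod wt F \<le> C * prod wt F"
      using assms(4) by (rule order_trans)
    then show ?thesis
      by (rule mult_right_le_imp_le) simp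
  qed
  then show ?thesis
    using \<open>j \<le> J\<close> by simp
qed

section \<open>A doubly exponential null sequence and its truncations\<close>

definition dlt :: "nat \<Rightarrow> real" where
  "dlt k = (1 / 2) ^ (2 ^ k)"

lemma dlt_pos [simp]: "0 < dlt k"
  by (simp add: dlt_def)

lemma dlt_le: "1 \<le> k \<Longrightarrow> dlt k \<le> 1 / 4"
proof -
  assume "1 \<le> k"
  then have "(2::nat) ^ 1 \<le> 2 ^ k"
    by (rule power_increasing) simp
  then have "dlt k \<le> (1 / 2) ^ 2"
    unfolding dlt_def by (intro power_decreasing) auto
  then show ?thesis
    by (simp add: power2_eq_square)
qed

text \<open>The square of \<open>dlt k\<close> is exactly \<open>dlt (Suc k)\<close>. This sparsity
  is what makes blow-ups of the sequence finite.\<close>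

lemma dlt_le_square: "k < l \<Longrightarrow> dlt l \<le> (dlt k)\<^sup>2"
proof -
  assume "k < l"
  then have "(2::nat) ^ Suc k \<le> 2 ^ l"
    by (intro power_increasing) auto
  then have "dlt l \<le> (1 / 2) ^ (2 ^ Suc k)"
    unfolding dlt_def by (rule power_decreasing) simp_all
  also have "\<dots> = (dlt k)\<^sup>2"
    by (simp add: dlt_def mult.commute flip: power_mult)
  finally show ?thesis .
qed

text \<open>The ratio bound starts at index 1, since \<open>dlt 0 = 1 / 2\<close> and
  \<open>dlt 1 = 1 / 4\<close>; the point sets below start there as well.\<close>

lemma dlt_quarter: "1 \<le> k \<Longrightarrow> k < l \<Longrightarrow> dlt l \<le> dlt k / 4"
proof -
  assume *: "1 \<le> k" "k < l"
  have "dlt l \<le> dlt k * dlt k"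
    using dlt_le_square[OF *(2)] by (simp add: power2_eq_square)
  also have "\<dots> \<le> dlt k * (1 / 4)"
    using * by (intro mult_left_mono dlt_le) (auto intro: less_imp_le)
  finally show ?thesis by simp
qed

lemma dlt_le_inverse: "dlt k \<le> inverse (real (Suc k))"
proof -
  have "Suc k \<le> (2::nat) ^ k"
    by (rule Suc_leI[OF less_exp])
  also have "\<dots> < 2 ^ (2 ^ k)"
    by (intro power_strict_increasing less_exp) simp
  finally have "real (Suc k) \<le> real (2 ^ (2 ^ k))"
    by (subst of_nat_le_iff) simp
  then show ?thesis
    unfolding dlt_def by (simp add: power_one_over inverse_eq_divide frac_le)
qed

lemma dlt_tendsto_0: "dlt \<longlonglongrightarrow> 0"
  by (rule tendsto_sandwich[OF _ _ tendsto_const LIMSEQ_inverse_real_of_nat])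
    (auto intro!: always_eventually less_imp_le[OF dlt_pos] dlt_le_inverse simp del: of_nat_Suc)

lemma dlt_less: "1 \<le> k \<Longrightarrow> k < l \<Longrightarrow> dlt l < dlt k"
  using dlt_quarter[of k l] dlt_pos[of k] by linarith

lemma dlt_less_iff: "1 \<le> k \<Longrightarrow> 1 \<le> l \<Longrightarrow> dlt k < dlt l \<longleftrightarrow> l < k"
  using dlt_less[of k l] dlt_less[of l k] by (cases k l rule: linorder_cases) auto

lemma dlt_eq_iff: "1 \<le> k \<Longrightarrow> 1 \<le> l \<Longrightarrow> dlt k = dlt l \<longleftrightarrow> k = l"
  by (metis dlt_less less_irrefl linorder_neqE_nat)

text \<open>The limit 0 is present only for the full sequence, so that these sets vary continuously
  with \<open>N\<close> along an ultrafilter; see \<open>seq_pts_limit\<close> and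
  \<open>seq_pts_approx\<close>.\<close>

definition seq_pts :: "enat \<Rightarrow> real set" where
  "seq_pts N = {dlt k | k. 1 \<le> k \<and> enat k \<le> N} \<union> {x. x = 0 \<and> N = \<infinity>}"

lemma seq_pts_cases:
  assumes "x \<in> seq_pts N"
  obtains k where "1 \<le> k" "enat k \<le> N" "x = dlt k" | "x = 0" "N = \<infinity>"
  using assms by (auto simp: seq_pts_def)

lemma dlt_in_seq_pts: "1 \<le> k \<Longrightarrow> dlt k \<in> seq_pts N \<longleftrightarrow> enat k \<le> N"
  using dlt_pos[of k] by (auto simp: seq_pts_def dlt_eq_iff)

lemma zero_in_seq_pts: "0 \<in> seq_pts N \<longleftrightarrow> N = \<infinity>"
  by (auto simp: seq_pts_def dlt_def)

lemma seq_pts_mono: "N \<le> M \<Longrightarrow> seq_pts N \<subseteq> seq_pts M"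
  by (auto elim!: seq_pts_cases simp: dlt_in_seq_pts zero_in_seq_pts intro: order_trans)

lemma seq_pts_bounds: "x \<in> seq_pts N \<Longrightarrow> 0 \<le> x \<and> x \<le> 1 / 4"
  using dlt_le by (auto elim!: seq_pts_cases simp: less_imp_le simp del: One_nat_def)

lemma seq_pts_diff_le_1: "x \<in> seq_pts N \<Longrightarrow> y \<in> seq_pts M \<Longrightarrow> \<bar>x - y\<bar> \<le> 1"
  using seq_pts_bounds[of x N] seq_pts_bounds[of y M] by auto

lemma countable_seq_pts: "countable (seq_pts N)"
proof -
  have "seq_pts N \<subseteq> insert 0 (range dlt)"
    by (auto simp: seq_pts_def)
  then show ?thesis
    by (rule countable_subset) simp
qed

lemma card_seq_pts: "card (seq_pts (enat m)) = m"
proof -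
  have "seq_pts (enat m) = dlt ` {1..m}"
    by (auto simp: seq_pts_def)
  moreover have "inj_on dlt {1..m}"
    by (auto simp: inj_on_def dlt_eq_iff)
  ultimately show ?thesis
    by (simp add: card_image)
qed

text \<open>Terms shrink by a factor of at least 4, so each nonzero one is isolated at a distance
  proportional to itself.\<close>

lemma seq_pts_gap:
  assumes "1 \<le> k" "z \<in> seq_pts N" "z \<noteq> dlt k"
  shows "dlt k / 2 \<le> \<bar>z - dlt k\<bar>"
  using assms(2)
proof (cases rule: seq_pts_cases)
  case (1 l)
  then show ?thesis
    using assms dlt_quarter[of k l] dlt_quarter[of l k] dlt_pos[of k] dlt_pos[of l]
    by (cases k l rule: linorder_cases) (auto simp: abs_if)
qed (simp add: abs_if)

text \<open>A smaller point satisfies \<open>v \<le> w\<^sup>2\<close> and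
  \<open>v \<le> w / 4\<close>. The second bound gives \<open>w - v \<ge> 3 / 4 * w\<close>, and the
  first then bounds \<open>v\<close> by \<open>16 / 9\<close> times the squared gap.\<close>

lemma seq_pts_less_imp_le_square:
  assumes "v \<in> seq_pts N" "w \<in> seq_pts M" "v < w"
  shows "v \<le> 2 * (w - v)\<^sup>2"
proof -
  have "0 \<le> v" using seq_pts_bounds[OF assms(1)] by simp
  obtain i where i: "1 \<le> i" "w = dlt i"
    using assms(2,3) \<open>0 \<le> v\<close> by (auto elim!: seq_pts_cases)
  have v: "v \<le> w\<^sup>2 \<and> v \<le> w / 4"
    using assms(1)
  proof (cases rule: seq_pts_cases)
    case (1 k)
    then have "i < k"
      using assms(3) i by (simp add: dlt_less_iff)
    then show ?thesis
      using 1 i dlt_le_square dlt_quarter by auto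
  qed (use i in \<open>auto intro: less_imp_le\<close>)
  then have "3 / 4 * w \<le> w - v" by simp
  then have "(3 / 4 * w)\<^sup>2 \<le> (w - v)\<^sup>2"
    by (rule power_mono) (use i in \<open>auto intro: less_imp_le\<close>)
  then have "9 / 16 * w\<^sup>2 \<le> (w - v)\<^sup>2"
    by (simp add: power2_eq_square)
  then show ?thesis
    using v zero_le_power2[of w] by linarith
qed

text \<open>Unless \<open>v = w\<close>, the middle point is itself at most
  \<open>2 * M\<^sup>2\<close>, hence so is its distance to the nonnegative point \<open>u\<close>
  below it.\<close>

lemma seq_pts_three_sorted:
  assumes "u \<in> seq_pts N1" "v \<in> seq_pts N2" "w \<in> seq_pts N3" "u \<le> v" "v \<le> w" "w - v \<le> M"
  shows "v - u \<le> 2 * M\<^sup>2 \<or> w - v \<le> 2 * M\<^sup>2"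
proof (cases "v = w")
  case False
  then have "v \<le> 2 * (w - v)\<^sup>2"
    using assms seq_pts_less_imp_le_square by auto
  moreover have "(w - v)\<^sup>2 \<le> M\<^sup>2"
    using assms by (intro power_mono) auto
  ultimately show ?thesis
    using seq_pts_bounds[OF assms(1)] by linarith
qed simp

text \<open>
  Since \<open>M\<^sup>2 / M\<close> vanishes as \<open>M\<close> does, a blow-up of the sequence has at most two points.
\<close>

lemma seq_pts_three:
  assumes "u \<in> seq_pts N1" "v \<in> seq_pts N2" "w \<in> seq_pts N3"
    and "\<bar>u - v\<bar> \<le> M" "\<bar>v - w\<bar> \<le> M" "\<bar>u - w\<bar> \<le> M"
  shows "\<bar>u - v\<bar> \<le> 2 * M\<^sup>2 \<or> \<bar>v - w\<bar> \<le> 2 * M\<^sup>2 \<or> \<bar>u - w\<bar> \<le> 2 * M\<^sup>2"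
proof -
  consider "u \<le> v" "v \<le> w" | "u \<le> w" "w \<le> v" | "v \<le> u" "u \<le> w"
    | "v \<le> w" "w \<le> u" | "w \<le> u" "u \<le> v" | "w \<le> v" "v \<le> u"
    by linarith
  then show ?thesis
  proof cases
    case 1 then show ?thesis using seq_pts_three_sorted[OF assms(1,2,3), of M] assms by auto
  next
    case 2 then show ?thesis using seq_pts_three_sorted[OF assms(1,3,2), of M] assms by auto
  next
    case 3 then show ?thesis using seq_pts_three_sorted[OF assms(2,1,3), of M] assms by auto
  next
    case 4 then show ?thesis using seq_pts_three_sorted[OF assms(2,3,1), of M] assms by auto
  next
    case 5 then show ?thesis using seq_pts_three_sorted[OF assms(3,1,2), of M] assms by auto
  next
    case 6 then show ?thesis using seq_pts_three_sorted[OF assms(3,2,1), of M] assms by auto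
  qed
qed

text \<open>Convergence in the one-point compactification of the naturals: for finite
  \<open>L\<close>, \<open>N\<close> eventually equals \<open>L\<close>; for
  \<open>L = \<infinity>\<close>, it eventually exceeds every bound.\<close>

definition enat_tends :: "nat filter \<Rightarrow> (nat \<Rightarrow> enat) \<Rightarrow> enat \<Rightarrow> bool" where
  "enat_tends \<mu> N L \<longleftrightarrow> (\<forall>j. eventually (\<lambda>n. enat j \<le> N n \<longleftrightarrow> enat j \<le> L) \<mu>)"

lemma enat_infinity_iff: "L = \<infinity> \<longleftrightarrow> (\<forall>j. enat j \<le> L)"
  by (cases L) (auto, metis Suc_n_not_le_n)

text \<open>Either \<open>x\<close> is eventually one fixed term, or every fixed term is eventually
  avoided. In the second case \<open>x\<close> tends to 0, which forces the truncation lengths to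
  tend to \<open>\<infinity>\<close>.\<close>

lemma (in nonprincipal) seq_pts_limit:
  assumes N: "enat_tends \<mu> N L" and x: "eventually (\<lambda>n. x n \<in> seq_pts (N n)) \<mu>"
  shows "\<exists>l\<in>seq_pts L. (x \<longlongrightarrow> l) \<mu>"
proof (cases "\<exists>k\<ge>1. eventually (\<lambda>n. x n = dlt k) \<mu>")
  case True
  then obtain k where k: "1 \<le> k" "eventually (\<lambda>n. x n = dlt k) \<mu>" by auto
  have "eventually (\<lambda>n. enat k \<le> N n \<longleftrightarrow> enat k \<le> L) \<mu>"
    using N by (auto simp: enat_tends_def)
  with k(2) x have "eventually (\<lambda>n. enat k \<le> L) \<mu>"
    by eventually_elim (use k(1) in \<open>auto simp: dlt_in_seq_pts\<close>)
  then have "dlt k \<in> seq_pts L"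
    using k(1) by (simp add: dlt_in_seq_pts)
  moreover have "(x \<longlongrightarrow> dlt k) \<mu>"
    using k(2) by (rule tendsto_eventually)
  ultimately show ?thesis by auto
next
  case False
  \<comment> \<open>Avoiding the first \<open>m\<close> terms bounds the length from below and the
    value from above at once.\<close>
  have late: "eventually (\<lambda>n. x n \<in> seq_pts (N n) \<and> enat m \<le> N n \<and> x n \<le> dlt m) \<mu>" if "1 \<le> m" for m
  proof -
    have "eventually (\<lambda>n. \<forall>k\<in>{1..m}. x n \<noteq> dlt k) \<mu>"
      using False by (intro eventually_ball_finite) (auto simp: eventually_not_iff)
    with x show ?thesis
    proof eventually_elim
      case (elim n)
      from elim(1) show ?case
      proof (cases rule: seq_pts_cases)
        case (1 k)
        with elim have "m < k" by (metis atLeastAtMost_iff not_less)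
        then show ?thesis
          using 1 elim that dlt_less_iff[of k m]
          by (auto intro: order_trans[of "enat m" "enat k"] less_imp_le)
      qed (use elim in \<open>auto intro: less_imp_le\<close>)
    qed
  qed
  have "enat j \<le> L" for j
  proof -
    have "eventually (\<lambda>n. enat (Suc j) \<le> N n \<longleftrightarrow> enat (Suc j) \<le> L) \<mu>"
      using N by (auto simp: enat_tends_def)
    moreover have "eventually (\<lambda>n. enat (Suc j) \<le> N n) \<mu>"
      using late[of "Suc j"] by (auto elim: eventually_mono)
    ultimately have "eventually (\<lambda>n. enat (Suc j) \<le> L) \<mu>"
      by eventually_elim auto
    then show ?thesis
      by (auto intro: order_trans[of "enat j" "enat (Suc j)"])
  qed
  then have "L = \<infinity>"
    by (simp add: enat_infinity_iff)
  moreover have "(x \<longlongrightarrow> 0) \<mu>"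
  proof (rule order_tendstoI)
    fix a :: real assume a: "a < 0"
    from x show "eventually (\<lambda>n. a < x n) \<mu>"
      by eventually_elim (use a seq_pts_bounds in force)
  next
    fix a :: real assume "0 < a"
    then have "eventually (\<lambda>m. dlt m < a) sequentially"
      using dlt_tendsto_0 by (simp add: order_tendstoD)
    then obtain m where "\<forall>k\<ge>m. dlt k < a"
      by (auto simp: eventually_sequentially)
    then have "dlt (Suc m) < a"
      by simp
    with late[of "Suc m"] show "eventually (\<lambda>n. x n < a) \<mu>"
      by (auto elim: eventually_mono)
  qed
  ultimately show ?thesis
    by (intro bexI[of _ 0]) (auto simp: zero_in_seq_pts)
qed

lemma (in nonprincipal) seq_pts_approx:
  assumes N: "enat_tends \<mu> N L" and l: "l \<in> seq_pts L"
  shows "\<exists>x. eventually (\<lambda>n. x n \<in> seq_pts (N n)) \<mu> \<and> (x \<longlongrightarrow> l) \<mu>"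
  using l
proof (cases rule: seq_pts_cases)
  case (1 k)
  have "eventually (\<lambda>n. enat k \<le> N n \<longleftrightarrow> enat k \<le> L) \<mu>"
    using N by (auto simp: enat_tends_def)
  then have "eventually (\<lambda>n. dlt k \<in> seq_pts (N n)) \<mu>"
    by eventually_elim (use 1 in \<open>auto simp: dlt_in_seq_pts\<close>)
  then show ?thesis
    using 1 by (intro exI[of _ "\<lambda>_. dlt k"]) auto
next
  case 2
  \<comment> \<open>The last term of each truncation. The value \<open>dlt 0\<close> at length 0 is
    not in the set, but that length occurs only outside a set of \<open>\<mu>\<close>.\<close>
  define x where "x = (\<lambda>n. case N n of enat k \<Rightarrow> dlt k | \<infinity> \<Rightarrow> 0)"
  have ev: "eventually (\<lambda>n. enat (Suc m) \<le> N n) \<mu>" for m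
    using N 2 by (auto simp: enat_tends_def)
  have "x n \<in> seq_pts (N n)" if "enat (Suc m) \<le> N n" for m n
    using that by (cases "N n") (auto simp: x_def dlt_in_seq_pts zero_in_seq_pts)
  then have "eventually (\<lambda>n. x n \<in> seq_pts (N n)) \<mu>"
    using ev[of 0] by (auto elim: eventually_mono)
  moreover have "(x \<longlongrightarrow> 0) \<mu>"
  proof (rule order_tendstoI)
    have "0 \<le> x n" for n
      by (auto simp: x_def less_imp_le split: enat.splits)
    then show "eventually (\<lambda>n. a < x n) \<mu>" if "a < 0" for a
      using that by (auto intro!: always_eventually intro: less_le_trans)
  next
    fix a :: real assume "0 < a"
    then have "eventually (\<lambda>m. dlt m < a) sequentially"
      using dlt_tendsto_0 by (simp add: order_tendstoD)
    then obtain m where m: "\<And>k. k \<ge> m \<Longrightarrow> dlt k < a"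
      by (auto simp: eventually_sequentially)
    show "eventually (\<lambda>n. x n < a) \<mu>"
      using ev[of m]
    proof eventually_elim
      case (elim n)
      then show ?case
        using m \<open>0 < a\<close> by (cases "N n") (auto simp: x_def)
    qed
  qed
  ultimately show ?thesis
    using 2 by auto
qed

section \<open>Radii, index sets and the metric\<close>

primrec rad :: "nat set option \<Rightarrow> real" where
  "rad None = 0"
| "rad (Some F) = prod wt F"

lemma rad_nonneg [simp]: "0 \<le> rad s"
  by (cases s) (auto intro: less_imp_le)

definition lowest :: "nat set \<Rightarrow> enat" where
  "lowest F = (INF s\<in>F. enat s)"

lemma le_lowest_iff: "enat j \<le> lowest F \<longleftrightarrow> (\<forall>s\<in>F. j \<le> s)"
  by (simp add: lowest_def le_INF_iff)

text \<open>
  \<open>lowest F\<close> is the minimum of \<open>F\<close>, with value \<open>\<infinity>\<close> for the empty set. The condition \<open>|F| \<le> min F\<close> of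
  Schreier forces a pointwise limit of a sequence of such sets along an ultrafilter to be finite.
\<close>

definition schreier :: "enat \<Rightarrow> nat set \<Rightarrow> bool" where
  "schreier h F \<longleftrightarrow> finite F \<and> h + enat (card F) \<le> lowest F"

type_synonym pt = "nat set option \<times> real \<times> real"

text \<open>The tag \<open>None\<close>, of radius 0, is reserved for the base point; the piece of
  the empty set has radius 1, the empty product.\<close>

definition origin :: pt where
  "origin = (None, 0, 0)"

text \<open>
  \<open>pts h\<close> is the \<open>h\<close>-th iterated cone: the piece at \<open>F\<close> has diameter at most \<open>rad (Some F)\<close> and lies at
  that distance from the origin. For finite \<open>h\<close> only the piece at \<open>F = {}\<close> is infinite.
\<close>

definition pts :: "enat \<Rightarrow> pt set" where
  "pts h = insert origin {(Some F, x, y) | F x y.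
     schreier h F \<and> x \<in> seq_pts (h + enat (card F)) \<and> y \<in> seq_pts (lowest F)}"

text \<open>Between pieces this is an ultrametric given by the radii. Coordinates lie in
  \<open>[0, 1 / 4]\<close>, so no piece is wider than its radius.\<close>

definition dst :: "pt \<Rightarrow> pt \<Rightarrow> real" where
  "dst = (\<lambda>(s, x, y) (t, x', y').
     if s = t then rad s * max \<bar>x - x'\<bar> \<bar>y - y'\<bar> else max (rad s) (rad t))"

lemma origin_in_pts [simp]: "origin \<in> pts h"
  by (simp add: pts_def)

lemma pts_cases:
  assumes "p \<in> pts h"
  obtains "p = origin" | F x y where "p = (Some F, x, y)" "schreier h F"
    "x \<in> seq_pts (h + enat (card F))" "y \<in> seq_pts (lowest F)"
  using assms by (auto simp: pts_def)

lemma dst_origin: "dst p origin = rad (fst p)" "dst origin p = rad (fst p)"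
  by (auto simp: dst_def origin_def split: prod.splits if_splits)

lemma pts_coords: "(s, x, y) \<in> pts h \<Longrightarrow> x \<in> seq_pts \<infinity> \<and> y \<in> seq_pts \<infinity>"
  using seq_pts_mono[of _ \<infinity>] by (auto simp: pts_def origin_def zero_in_seq_pts)

lemma dst_commute: "dst p q = dst q p"
  by (auto simp: dst_def max.commute abs_minus_commute split: prod.splits)

lemma dst_le: "p \<in> pts h \<Longrightarrow> q \<in> pts h \<Longrightarrow> dst p q \<le> max (rad (fst p)) (rad (fst q))"
proof -
  assume *: "p \<in> pts h" "q \<in> pts h"
  obtain s x y t x' y' where [simp]: "p = (s, x, y)" "q = (t, x', y')"
    by (metis prod_cases3)
  have "max \<bar>x - x'\<bar> \<bar>y - y'\<bar> \<le> 1"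
    using * by (auto dest!: pts_coords intro: seq_pts_diff_le_1)
  then have "rad s * max \<bar>x - x'\<bar> \<bar>y - y'\<bar> \<le> rad s * 1"
    by (intro mult_left_mono) auto
  then show ?thesis
    by (auto simp: dst_def)
qed

lemma Metric_space_pts: "Metric_space (pts h) dst"
proof
  fix p q r :: pt
  obtain s x y where [simp]: "p = (s, x, y)" by (metis prod_cases3)
  obtain t x' y' where [simp]: "q = (t, x', y')" by (metis prod_cases3)
  obtain u x'' y'' where [simp]: "r = (u, x'', y'')" by (metis prod_cases3)
  show "0 \<le> dst p q"
    by (auto simp: dst_def le_max_iff_disj intro!: mult_nonneg_nonneg)
  show "dst p q = dst q p"
    by (rule dst_commute)
  assume p: "p \<in> pts h" and q: "q \<in> pts h"
  show "dst p q = 0 \<longleftrightarrow> p = q"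
    using p q by (auto simp: dst_def pts_def origin_def max_def split: if_splits)
  assume r: "r \<in> pts h"
  show "dst p r \<le> dst p q + dst q r"
  proof (cases "s = t \<and> t = u")
    case True
    have "rad s * max \<bar>x - x''\<bar> \<bar>y - y''\<bar> \<le> rad s * (max \<bar>x - x'\<bar> \<bar>y - y'\<bar> + max \<bar>x' - x''\<bar> \<bar>y' - y''\<bar>)"
      by (rule mult_left_mono) auto
    then show ?thesis
      using True by (simp add: dst_def algebra_simps)
  next
    case False
    have nn: "0 \<le> dst a b" for a b
      by (auto simp: dst_def le_max_iff_disj intro!: mult_nonneg_nonneg split: prod.splits)
    \<comment> \<open>Once the three tags are not all equal, the larger of the end radii separates
      the two sides; \<open>dst_le\<close> bounds the left side by it.\<close>
    have "max (rad s) (rad u) \<le> dst p q + dst q r"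
    proof (cases "s = t \<or> t = u")
      case True
      then have "max (rad s) (rad u) = dst p q \<or> max (rad s) (rad u) = dst q r"
        using False by (auto simp: dst_def)
      then show ?thesis
        using nn[of p q] nn[of q r] by linarith
    next
      case False
      then have "dst p q + dst q r = max (rad s) (rad t) + max (rad t) (rad u)"
        by (simp add: dst_def)
      then show ?thesis
        using rad_nonneg[of s] rad_nonneg[of t] rad_nonneg[of u] by linarith
    qed
    moreover have "dst p r \<le> max (rad s) (rad u)"
      using dst_le[OF p r] by simp
    ultimately show ?thesis
      by linarith
  qed
qed

text \<open>Allows the space to be realised on a set of real numbers in
  \<open>model_in_real\<close>.\<close>

lemma countable_pts: "countable (pts h)"
proof -
  have "pts h \<subseteq> insert origin (Some ` {F. finite F} \<times> seq_pts \<infinity> \<times> seq_pts \<infinity>)"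
  proof
    fix p assume "p \<in> pts h"
    then show "p \<in> insert origin (Some ` {F. finite F} \<times> seq_pts \<infinity> \<times> seq_pts \<infinity>)"
      using pts_coords[of "fst p" "fst (snd p)" "snd (snd p)" h]
      by (auto simp: pts_def schreier_def)
  qed
  moreover have "countable (insert origin (Some ` {F::nat set. finite F} \<times> seq_pts \<infinity> \<times> seq_pts \<infinity>))"
    by (intro countable_insert countable_SIGMA countable_image countable_seq_pts countable_Collect_finite)
  ultimately show ?thesis
    by (rule countable_subset)
qed

section \<open>Cones of the model spaces\<close>

lemma enat_le_add_iff: "enat j \<le> N + enat k \<longleftrightarrow> enat (j - k) \<le> N"
  by (cases N) auto

lemma enat_le_by_nat: "(\<And>j. enat j \<le> N \<Longrightarrow> enat j \<le> M) \<Longrightarrow> N \<le> M"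
  by (cases N; cases M) (auto, metis Suc_n_not_le_n)

lemma enat_tends_add: "enat_tends \<mu> N L \<Longrightarrow> enat_tends \<mu> (\<lambda>n. N n + enat k) (L + enat k)"
  by (simp add: enat_tends_def enat_le_add_iff)

lemma enat_tends_cong:
  assumes "enat_tends \<mu> N L" "eventually (\<lambda>n. M n = N n) \<mu>"
  shows "enat_tends \<mu> M L"
  unfolding enat_tends_def
proof
  fix j
  have "eventually (\<lambda>n. enat j \<le> N n \<longleftrightarrow> enat j \<le> L) \<mu>"
    using assms(1) by (simp add: enat_tends_def)
  with assms(2) show "eventually (\<lambda>n. enat j \<le> M n \<longleftrightarrow> enat j \<le> L) \<mu>"
    by eventually_elim simp
qed

lemma (in nonprincipal) enat_tends_exists: "\<exists>L. enat_tends \<mu> N L"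
proof (cases "\<forall>j. eventually (\<lambda>n. enat j \<le> N n) \<mu>")
  case True
  then show ?thesis
    by (intro exI[of _ \<infinity>]) (auto simp: enat_tends_def)
next
  case False
  \<comment> \<open>The first threshold that fails. It is positive because 0 never fails, and its
    predecessor is the limit.\<close>
  define k where "k = (LEAST j. \<not> eventually (\<lambda>n. enat j \<le> N n) \<mu>)"
  have k: "\<not> eventually (\<lambda>n. enat k \<le> N n) \<mu>"
    unfolding k_def using False
    by (intro LeastI_ex[where P = "\<lambda>j. \<not> eventually (\<lambda>n. enat j \<le> N n) \<mu>"]) blast
  have below: "eventually (\<lambda>n. enat j \<le> N n) \<mu>" if "j < k" for j
    using that not_less_Least unfolding k_def by blast
  have "k \<noteq> 0"
    using k by (metis (mono_tags, lifting) always_eventually zero_enat_def zero_le)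
  have "enat_tends \<mu> N (enat (k - 1))"
    unfolding enat_tends_def
  proof
    fix j
    show "eventually (\<lambda>n. enat j \<le> N n \<longleftrightarrow> enat j \<le> enat (k - 1)) \<mu>"
    proof (cases "j < k")
      case True
      then show ?thesis
        using below[OF True] by (auto elim!: eventually_mono)
    next
      case False
      have "eventually (\<lambda>n. \<not> enat k \<le> N n) \<mu>"
        using k by (simp add: eventually_not_iff)
      then show ?thesis
      proof eventually_elim
        case (elim n)
        then show ?case
          using False \<open>k \<noteq> 0\<close> order_trans[of "enat k" "enat j" "N n"] by auto
      qed
    qed
  qed
  then show ?thesis ..
qed

lemma rad_origin [simp]: "rad (fst origin) = 0"
  by (simp add: origin_def)

text \<open>The base point stays within a bounded multiple of the scale, so the origin is visible
  and boundedness can be measured from it.\<close>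

locale model_cone = cone_data \<mu> Y "pts h" dst g b \<beta>
  for \<mu> and Y :: "'a metric" and h :: enat and g :: "pt \<Rightarrow> 'a" and b \<beta> +
  assumes base_bounded: "\<exists>K. eventually (\<lambda>n. rad (fst (b n)) \<le> K * \<beta> n) \<mu>"
begin

lemma bounded_seqs_iff:
  "p \<in> bounded_seqs \<longleftrightarrow>
     range p \<subseteq> pts h \<and> (\<exists>K. eventually (\<lambda>n. rad (fst (p n)) \<le> K * \<beta> n) \<mu>)"
proof -
  obtain K0 where K0: "eventually (\<lambda>n. rad (fst (b n)) \<le> K0 * \<beta> n) \<mu>"
    using base_bounded by auto
  have "(\<exists>K. eventually (\<lambda>n. dst (p n) (b n) \<le> K * \<beta> n) \<mu>) \<longleftrightarrow>
      (\<exists>K. eventually (\<lambda>n. rad (fst (p n)) \<le> K * \<beta> n) \<mu>)" if p: "range p \<subseteq> pts h"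
  proof
    assume "\<exists>K. eventually (\<lambda>n. dst (p n) (b n) \<le> K * \<beta> n) \<mu>"
    then obtain K where "eventually (\<lambda>n. dst (p n) (b n) \<le> K * \<beta> n) \<mu>" ..
    with K0 have "eventually (\<lambda>n. rad (fst (p n)) \<le> max K K0 * \<beta> n) \<mu>"
    proof eventually_elim
      case (elim n)
      have "rad (fst (p n)) \<le> max (dst (p n) (b n)) (rad (fst (b n)))"
        by (auto simp: dst_def split: prod.splits)
      also have "\<dots> \<le> max (K * \<beta> n) (K0 * \<beta> n)"
        using elim by (intro max.mono)
      also have "\<dots> \<le> max K K0 * \<beta> n"
        using scale_pos[of n] by (auto intro: mult_right_mono)
      finally show ?case .
    qed
    then show "\<exists>K. eventually (\<lambda>n. rad (fst (p n)) \<le> K * \<beta> n) \<mu>" ..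
  next
    assume "\<exists>K. eventually (\<lambda>n. rad (fst (p n)) \<le> K * \<beta> n) \<mu>"
    then obtain K where "eventually (\<lambda>n. rad (fst (p n)) \<le> K * \<beta> n) \<mu>" ..
    with K0 have "eventually (\<lambda>n. dst (p n) (b n) \<le> max K K0 * \<beta> n) \<mu>"
    proof eventually_elim
      case (elim n)
      have "dst (p n) (b n) \<le> max (rad (fst (p n))) (rad (fst (b n)))"
        using p base by (intro dst_le) auto
      also have "\<dots> \<le> max (K * \<beta> n) (K0 * \<beta> n)"
        using elim by (intro max.mono)
      also have "\<dots> \<le> max K K0 * \<beta> n"
        using scale_pos[of n] by (auto intro: mult_right_mono)
      finally show ?case .
    qed
    then show "\<exists>K. eventually (\<lambda>n. dst (p n) (b n) \<le> K * \<beta> n) \<mu>" ..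
  qed
  then show ?thesis
    by (auto simp: bounded_seqs_def)
qed

lemma origin_bounded: "(\<lambda>_. origin) \<in> bounded_seqs"
  by (auto simp: bounded_seqs_iff intro!: exI[of _ 0])

end

text \<open>
  At scale \<open>\<beta> n\<close> comparable to the radius of the piece \<open>H n\<close>, the visible pieces are those indexed
  by \<open>H n \<union> F\<close> with \<open>F\<close> a fixed finite set.
\<close>

locale resonant_cone = model_cone \<mu> Y h g b \<beta>
  for \<mu> and Y :: "'a metric" and h g b \<beta> +
  fixes H :: "nat \<Rightarrow> nat set" and h' :: enat and c :: real
  assumes escapes: "\<And>j. eventually (\<lambda>n. j \<notin> H n) \<mu>"
    and H_schreier: "eventually (\<lambda>n. schreier h (H n)) \<mu>"
    and card_tends: "enat_tends \<mu> (\<lambda>n. h + enat (card (H n))) h'"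
    and radius_tends: "((\<lambda>n. prod wt (H n) / \<beta> n) \<longlongrightarrow> c) \<mu>"
    and c_pos: "0 < c"
begin

text \<open>A tag of the cone records the part of the index set that does not move with
  \<open>n\<close>.\<close>

abbreviation lift :: "nat \<Rightarrow> nat set option \<Rightarrow> nat set option" where
  "lift n \<equiv> map_option (\<lambda>F. H n \<union> F)"

lemma H_above: "eventually (\<lambda>n. \<forall>i\<in>H n. k \<le> i) \<mu>"
proof -
  have "eventually (\<lambda>n. \<forall>j\<in>{..<k}. j \<notin> H n) \<mu>"
    using escapes by (intro eventually_ball_finite) auto
  then show ?thesis
    by eventually_elim (metis lessThan_iff not_less)
qed

lemma H_disjoint:
  assumes "finite F"
  shows "eventually (\<lambda>n. H n \<inter> F = {}) \<mu>"
proof -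
  have "eventually (\<lambda>n. \<forall>j\<in>F. j \<notin> H n) \<mu>"
    using escapes assms by (intro eventually_ball_finite) auto
  then show ?thesis
    by eventually_elim auto
qed

lemma H_finite: "eventually (\<lambda>n. finite (H n)) \<mu>"
  using H_schreier by eventually_elim (simp add: schreier_def)

lemma card_union:
  assumes "finite F"
  shows "eventually (\<lambda>n. card (H n \<union> F) = card (H n) + card F) \<mu>"
  using H_finite H_disjoint[OF assms] by eventually_elim (use assms in \<open>simp add: card_Un_disjoint\<close>)

lemma card_union_tends:
  assumes "finite F"
  shows "enat_tends \<mu> (\<lambda>n. h + enat (card (H n \<union> F))) (h' + enat (card F))"
proof (rule enat_tends_cong[OF enat_tends_add[OF card_tends]])
  show "eventually (\<lambda>n. h + enat (card (H n \<union> F)) = h + enat (card (H n)) + enat (card F)) \<mu>"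
    using card_union[OF assms] by eventually_elim (simp add: add.assoc)
qed

lemma lowest_union_tends: "enat_tends \<mu> (\<lambda>n. lowest (H n \<union> F)) (lowest F)"
  unfolding enat_tends_def
proof
  fix j
  show "eventually (\<lambda>n. enat j \<le> lowest (H n \<union> F) \<longleftrightarrow> enat j \<le> lowest F) \<mu>"
    using H_above[of j] by eventually_elim (auto simp: le_lowest_iff)
qed

text \<open>Since \<open>H n\<close> escapes, in the limit only its cardinality is felt, through
  \<open>h'\<close>, while the minimum is that of \<open>F\<close>.\<close>

lemma schreier_union_iff:
  assumes "finite F"
  shows "eventually (\<lambda>n. schreier h (H n \<union> F)) \<mu> \<longleftrightarrow> schreier h' F"
proof
  assume ev: "eventually (\<lambda>n. schreier h (H n \<union> F)) \<mu>"
  have "h' + enat (card F) \<le> lowest F"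
  proof (rule enat_le_by_nat)
    fix j assume j: "enat j \<le> h' + enat (card F)"
    have "eventually (\<lambda>n. enat j \<le> h + enat (card (H n \<union> F)) \<longleftrightarrow> enat j \<le> h' + enat (card F)) \<mu>"
      using card_union_tends[OF assms] by (simp add: enat_tends_def)
    with ev have "eventually (\<lambda>n. enat j \<le> lowest F) \<mu>"
    proof eventually_elim
      case (elim n)
      then have "enat j \<le> lowest (H n \<union> F)"
        using j by (auto simp: schreier_def intro: order_trans)
      then show ?case
        by (auto simp: le_lowest_iff)
    qed
    then show "enat j \<le> lowest F" by simp
  qed
  then show "schreier h' F"
    using assms by (simp add: schreier_def)
next
  assume F: "schreier h' F"
  show "eventually (\<lambda>n. schreier h (H n \<union> F)) \<mu>"
  \<comment> \<open>For empty \<open>F\<close> the limit condition is vacuous, and the assumption on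
    \<open>H n\<close> itself is used.\<close>
  proof (cases "F = {}")
    case True
    then show ?thesis using H_schreier by simp
  next
    case False
    then obtain i where "i \<in> F" by auto
    then have "lowest F \<le> enat i"
      unfolding lowest_def by (rule INF_lower)
    then obtain m where m: "lowest F = enat m"
      by (cases "lowest F") auto
    \<comment> \<open>The limit value is at most \<open>m\<close>; testing convergence at
      \<open>Suc m\<close> shows that the values before the limit are eventually at most
      \<open>m\<close> too.\<close>
    have "eventually (\<lambda>n. enat (Suc m) \<le> h + enat (card (H n \<union> F)) \<longleftrightarrow> enat (Suc m) \<le> h' + enat (card F)) \<mu>"
      using card_union_tends[OF assms] by (simp add: enat_tends_def)
    with H_finite H_above[of m] show ?thesis
    proof eventually_elim
      case (elim n)
      have "\<not> enat (Suc m) \<le> h' + enat (card F)"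
        using F m order_trans[of "enat (Suc m)" "h' + enat (card F)" "enat m"] by (auto simp: schreier_def)
      then have "h + enat (card (H n \<union> F)) \<le> enat m"
        using elim by (cases "h + enat (card (H n \<union> F))") auto
      moreover have "enat m \<le> lowest (H n \<union> F)"
        using elim m le_lowest_iff[of m F] by (auto simp: le_lowest_iff)
      ultimately show ?case
        using elim assms by (simp add: schreier_def)
    qed
  qed
qed

text \<open>Eventually \<open>H n\<close> and \<open>F\<close> are disjoint, so the product over the
  union factors.\<close>

lemma lift_radius:
  assumes "\<And>F. s = Some F \<Longrightarrow> finite F"
  shows "((\<lambda>n. rad (lift n s) / \<beta> n) \<longlongrightarrow> c * rad s) \<mu>"
proof (cases s)
  case (Some F)
  have "eventually (\<lambda>n. prod wt (H n) / \<beta> n * prod wt F = rad (lift n s) / \<beta> n) \<mu>"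
    using H_finite H_disjoint[OF assms[OF Some]]
    by eventually_elim (use assms Some in \<open>simp add: prod.union_disjoint\<close>)
  moreover have "((\<lambda>n. prod wt (H n) / \<beta> n * prod wt F) \<longlongrightarrow> c * prod wt F) \<mu>"
    by (intro tendsto_intros radius_tends)
  ultimately show ?thesis
    using Some by (simp add: Lim_transform_eventually)
qed simp

lemma lift_inject:
  assumes "\<And>F. s = Some F \<Longrightarrow> finite F" "\<And>F. t = Some F \<Longrightarrow> finite F"
  shows "eventually (\<lambda>n. lift n s = lift n t \<longleftrightarrow> s = t) \<mu>"
proof (cases s)
  case (Some F)
  show ?thesis
  proof (cases t)
    case (Some G)
    have "eventually (\<lambda>n. H n \<inter> F = {}) \<mu>" "eventually (\<lambda>n. H n \<inter> G = {}) \<mu>"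
      using assms \<open>s = Some F\<close> Some by (auto intro: H_disjoint)
    then show ?thesis
      by eventually_elim (use Some \<open>s = Some F\<close> in auto)
  qed (use Some in simp)
qed (cases t; simp)

lemma dst_lift_tends:
  assumes "\<And>F. s = Some F \<Longrightarrow> finite F" "\<And>F. t = Some F \<Longrightarrow> finite F"
    and "eventually (\<lambda>n. fst (p n) = lift n s) \<mu>" "eventually (\<lambda>n. fst (q n) = lift n t) \<mu>"
    and "((\<lambda>n. fst (snd (p n))) \<longlongrightarrow> x) \<mu>" "((\<lambda>n. snd (snd (p n))) \<longlongrightarrow> y) \<mu>"
    and "((\<lambda>n. fst (snd (q n))) \<longlongrightarrow> x') \<mu>" "((\<lambda>n. snd (snd (q n))) \<longlongrightarrow> y') \<mu>"
  shows "((\<lambda>n. dst (p n) (q n) / \<beta> n) \<longlongrightarrow> c * dst (s, x, y) (t, x', y')) \<mu>"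
proof (cases "s = t")
  case True
  have "((\<lambda>n. rad (lift n s) / \<beta> n * max \<bar>fst (snd (p n)) - fst (snd (q n))\<bar> \<bar>snd (snd (p n)) - snd (snd (q n))\<bar>)
      \<longlongrightarrow> c * rad s * max \<bar>x - x'\<bar> \<bar>y - y'\<bar>) \<mu>"
    by (intro tendsto_intros lift_radius assms)
  moreover have "eventually (\<lambda>n. rad (lift n s) / \<beta> n * max \<bar>fst (snd (p n)) - fst (snd (q n))\<bar> \<bar>snd (snd (p n)) - snd (snd (q n))\<bar>
      = dst (p n) (q n) / \<beta> n) \<mu>"
    using assms(3,4) by eventually_elim (use True in \<open>auto simp: dst_def split: prod.splits\<close>)
  ultimately show ?thesis
    using True by (simp add: dst_def Lim_transform_eventually mult.assoc)
next
  case False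
  have inj: "eventually (\<lambda>n. lift n s = lift n t \<longleftrightarrow> s = t) \<mu>"
    using assms(1,2) by (rule lift_inject)
  have "((\<lambda>n. max (rad (lift n s) / \<beta> n) (rad (lift n t) / \<beta> n)) \<longlongrightarrow> max (c * rad s) (c * rad t)) \<mu>"
    by (intro tendsto_intros lift_radius assms)
  moreover have "eventually (\<lambda>n. max (rad (lift n s) / \<beta> n) (rad (lift n t) / \<beta> n) = dst (p n) (q n) / \<beta> n) \<mu>"
    using assms(3,4) inj
  proof eventually_elim
    case (elim n)
    have "max (rad (lift n s) / \<beta> n) (rad (lift n t) / \<beta> n) = max (rad (lift n s)) (rad (lift n t)) / \<beta> n"
      using scale_pos[of n] by (auto simp: max_def divide_le_cancel)
    then show ?case
      using elim False by (auto simp: dst_def split: prod.splits)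
  qed
  moreover have "max (c * rad s) (c * rad t) = c * max (rad s) (rad t)"
    using c_pos by (auto simp: max_def)
  ultimately show ?thesis
    using False by (simp add: dst_def Lim_transform_eventually)
qed

definition approximates :: "(nat \<Rightarrow> pt) \<Rightarrow> pt \<Rightarrow> bool" where
  "approximates p q \<longleftrightarrow> range p \<subseteq> pts h \<and> eventually (\<lambda>n. fst (p n) = lift n (fst q)) \<mu> \<and>
     ((\<lambda>n. fst (snd (p n))) \<longlongrightarrow> fst (snd q)) \<mu> \<and> ((\<lambda>n. snd (snd (p n))) \<longlongrightarrow> snd (snd q)) \<mu>"

lemma pts_finite: "q \<in> pts k \<Longrightarrow> fst q = Some F \<Longrightarrow> finite F"
  by (auto simp: pts_def origin_def schreier_def)

lemma approximates_dst:
  assumes "q \<in> pts h'" "q' \<in> pts h'" "approximates p q" "approximates p' q'"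
  shows "((\<lambda>n. dst (p n) (p' n) / \<beta> n) \<longlongrightarrow> c * dst q q') \<mu>"
  using dst_lift_tends[of "fst q" "fst q'" p p' "fst (snd q)" "snd (snd q)" "fst (snd q')" "snd (snd q')"]
    pts_finite assms by (simp add: approximates_def)

lemma approximates_origin: "approximates (\<lambda>_. origin) origin"
  by (auto simp: approximates_def) (auto simp: origin_def)

lemma approximates_bounded:
  assumes "q \<in> pts h'" "approximates p q"
  shows "p \<in> bounded_seqs"
proof -
  have "((\<lambda>n. dst (p n) origin / \<beta> n) \<longlongrightarrow> c * dst q origin) \<mu>"
    using assms approximates_origin by (intro approximates_dst) auto
  then have "eventually (\<lambda>n. dst (p n) origin / \<beta> n < c * dst q origin + 1) \<mu>"
    by (rule order_tendstoD) simp
  then have "eventually (\<lambda>n. rad (fst (p n)) \<le> (c * dst q origin + 1) * \<beta> n) \<mu>"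
    by eventually_elim (use scale_pos in \<open>auto simp: dst_origin pos_divide_less_eq less_imp_le\<close>)
  then show ?thesis
    using assms by (auto simp: bounded_seqs_iff approximates_def)
qed

lemma approximates_exists:
  assumes "q \<in> pts h'"
  shows "\<exists>p. approximates p q \<and> (q = origin \<longrightarrow> p = (\<lambda>_. origin))"
  using assms
proof (cases rule: pts_cases)
  case 1
  then show ?thesis using approximates_origin by blast
next
  case (2 F x y)
  then have fin: "finite F" by (simp add: schreier_def)
  obtain xs where xs: "eventually (\<lambda>n. xs n \<in> seq_pts (h + enat (card (H n \<union> F)))) \<mu>" "(xs \<longlongrightarrow> x) \<mu>"
    using seq_pts_approx[OF card_union_tends[OF fin]] 2 by blast
  obtain ys where ys: "eventually (\<lambda>n. ys n \<in> seq_pts (lowest (H n \<union> F))) \<mu>" "(ys \<longlongrightarrow> y) \<mu>"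
    using seq_pts_approx[OF lowest_union_tends] 2 by blast
  \<comment> \<open>The fallback to \<open>origin\<close> outside a set of \<open>\<mu>\<close>
    keeps every term in \<open>pts h\<close>.\<close>
  define p where "p n = (let r = (Some (H n \<union> F), xs n, ys n) in if r \<in> pts h then r else origin)" for n
  have "eventually (\<lambda>n. schreier h (H n \<union> F)) \<mu>"
    using schreier_union_iff[OF fin] 2 by simp
  with xs(1) ys(1) have ev: "eventually (\<lambda>n. p n = (Some (H n \<union> F), xs n, ys n)) \<mu>"
    by eventually_elim (auto simp: p_def pts_def)
  have "approximates p q"
    unfolding approximates_def
  proof (intro conjI)
    show "range p \<subseteq> pts h"
      by (auto simp: p_def Let_def)
    show "eventually (\<lambda>n. fst (p n) = lift n (fst q)) \<mu>"
      using ev by eventually_elim (simp add: 2)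
    have "eventually (\<lambda>n. xs n = fst (snd (p n))) \<mu>" "eventually (\<lambda>n. ys n = snd (snd (p n))) \<mu>"
      using ev by (auto elim: eventually_mono)
    then show "((\<lambda>n. fst (snd (p n))) \<longlongrightarrow> fst (snd q)) \<mu>" "((\<lambda>n. snd (snd (p n))) \<longlongrightarrow> snd (snd q)) \<mu>"
      using Lim_transform_eventually[OF xs(2)] Lim_transform_eventually[OF ys(2)] by (simp_all add: 2)
  qed
  moreover have "q \<noteq> origin"
    by (simp add: 2 origin_def)
  ultimately show ?thesis by blast
qed

text \<open>A radius that is not negligible is comparable with that of \<open>H n\<close>, so the
  index sets differ only below a fixed bound. The ultrafilter freezes this finite difference, and
  the coordinates converge by \<open>seq_pts_limit\<close>.\<close>

lemma bounded_approximates: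
  assumes p: "p \<in> bounded_seqs"
  shows "((\<lambda>n. rad (fst (p n)) / \<beta> n) \<longlongrightarrow> 0) \<mu> \<or> (\<exists>q\<in>pts h'. approximates p q)"
proof (rule disj_commute[THEN iffD1], rule disjCI)
  assume "\<not> ((\<lambda>n. rad (fst (p n)) / \<beta> n) \<longlongrightarrow> 0) \<mu>"
  then obtain \<epsilon> where \<epsilon>: "\<epsilon> > 0" "eventually (\<lambda>n. \<epsilon> \<le> rad (fst (p n)) / \<beta> n) \<mu>"
    using tendsto_0_or_bounded_below[of "\<lambda>n. rad (fst (p n)) / \<beta> n"] scale_pos
    by (auto simp: less_imp_le)
  obtain K where K: "eventually (\<lambda>n. rad (fst (p n)) \<le> K * \<beta> n) \<mu>" and range: "range p \<subseteq> pts h"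
    using p by (auto simp: bounded_seqs_iff)
  \<comment> \<open>Bounds the ratio of the two products both ways: the normalised radius of
    \<open>H n\<close> is eventually between \<open>c / 2\<close> and \<open>c + 1\<close>, that of
    \<open>p n\<close> between \<open>\<epsilon>\<close> and \<open>K\<close>. Using
    \<open>max K 1\<close> keeps the numerator positive.\<close>
  define C where "C = max (max K 1 / (c / 2)) ((c + 1) / \<epsilon>)"
  have "eventually (\<lambda>n. c / 2 < prod wt (H n) / \<beta> n) \<mu>" "eventually (\<lambda>n. prod wt (H n) / \<beta> n < c + 1) \<mu>"
    by (rule order_tendstoD[OF radius_tends]; use c_pos in simp)+
  with \<epsilon>(2) K H_finite
  have "eventually (\<lambda>n. \<exists>G. fst (p n) = Some G \<and> (\<forall>j\<in>sym_diff G (H n). real j \<le> C)) \<mu>"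
  proof eventually_elim
    case (elim n)
    have "rad (fst (p n)) \<noteq> 0"
      using elim(1) \<epsilon>(1) by auto
    then obtain G where G: "fst (p n) = Some G"
      by (cases "fst (p n)") auto
    have Gfin: "finite G"
      using range G pts_finite[of "p n" h G] by auto
    have b: "\<epsilon> * \<beta> n \<le> prod wt G" "prod wt G \<le> K * \<beta> n" "c / 2 * \<beta> n \<le> prod wt (H n)" "prod wt (H n) \<le> (c + 1) * \<beta> n"
      using elim G scale_pos[of n] by (auto simp: pos_le_divide_eq pos_less_divide_eq pos_divide_less_eq less_imp_le)
    have "prod wt G \<le> max K 1 / (c / 2) * (c / 2 * \<beta> n)"
      using b(2) c_pos scale_pos[of n] by (auto intro: order_trans mult_right_mono)
    also have "\<dots> \<le> C * prod wt (H n)"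
      using b(3) c_pos \<epsilon>(1) scale_pos[of n] by (intro mult_mono) (auto simp: C_def le_max_iff_disj)
    finally have 1: "prod wt G \<le> C * prod wt (H n)" .
    have "prod wt (H n) \<le> (c + 1) / \<epsilon> * (\<epsilon> * \<beta> n)"
      using b(4) \<epsilon>(1) by simp
    also have "\<dots> \<le> C * prod wt G"
      using b(1) c_pos \<epsilon>(1) scale_pos[of n] by (intro mult_mono) (auto simp: C_def le_max_iff_disj)
    finally have "prod wt (H n) \<le> C * prod wt G" .
    with 1 have "\<forall>j\<in>sym_diff G (H n). real j \<le> C"
      using sym_diff_le_of_comparable[OF Gfin elim(3)] by blast
    then show ?case using G by blast
  qed
  then have "eventually (\<lambda>n. \<exists>F\<in>Pow {j. real j \<le> C}. \<exists>G. fst (p n) = Some G \<and> sym_diff G (H n) = F) \<mu>"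
    by eventually_elim auto
  moreover have fC: "finite {j. real j \<le> C}"
    by (rule finite_subset[of _ "{..nat \<lfloor>C\<rfloor>}"]) (auto intro: le_nat_floor)
  ultimately obtain F where F: "F \<subseteq> {j. real j \<le> C}"
      "eventually (\<lambda>n. \<exists>G. fst (p n) = Some G \<and> sym_diff G (H n) = F) \<mu>"
    using eventually_bex_finite[of "Pow {j. real j \<le> C}" "\<lambda>F n. \<exists>G. fst (p n) = Some G \<and> sym_diff G (H n) = F"]
    by (auto simp del: Un_iff)
  have fin: "finite F"
    using F(1) fC finite_subset by blast
  \<comment> \<open>As \<open>H n\<close> is disjoint from \<open>F\<close>, a set whose symmetric
    difference with \<open>H n\<close> is \<open>F\<close> must be their union.\<close>
  have tag: "eventually (\<lambda>n. fst (p n) = Some (H n \<union> F)) \<mu>"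
    using F(2) H_disjoint[OF fin] by eventually_elim auto
  have mem: "eventually (\<lambda>n. schreier h (H n \<union> F) \<and> fst (snd (p n)) \<in> seq_pts (h + enat (card (H n \<union> F)))
      \<and> snd (snd (p n)) \<in> seq_pts (lowest (H n \<union> F))) \<mu>"
    using tag
  proof eventually_elim
    case (elim n)
    have "p n \<in> pts h" using range by auto
    then show ?case
      using elim by (cases rule: pts_cases) (auto simp: origin_def)
  qed
  then have "eventually (\<lambda>n. schreier h (H n \<union> F)) \<mu>"
    by (auto elim: eventually_mono)
  then have sF: "schreier h' F"
    using schreier_union_iff[OF fin] by simp
  obtain x where x: "x \<in> seq_pts (h' + enat (card F))" "((\<lambda>n. fst (snd (p n))) \<longlongrightarrow> x) \<mu>"
    using seq_pts_limit[OF card_union_tends[OF fin], of "\<lambda>n. fst (snd (p n))"] mem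
    by (auto simp: eventually_conj_iff)
  obtain y where y: "y \<in> seq_pts (lowest F)" "((\<lambda>n. snd (snd (p n))) \<longlongrightarrow> y) \<mu>"
    using seq_pts_limit[OF lowest_union_tends, of "\<lambda>n. snd (snd (p n))"] mem
    by (auto simp: eventually_conj_iff)
  have "approximates p (Some F, x, y)" "(Some F, x, y) \<in> pts h'"
    using range tag x y sF by (auto simp: approximates_def pts_def)
  then show "\<exists>q\<in>pts h'. approximates p q" by blast
qed

text \<open>The clause on \<open>origin\<close> lets base points be followed through the
  iteration.\<close>

theorem param_resonant_cone:
  "\<exists>g'. param (Cone \<mu> Y (\<lambda>n. g (b n)) \<beta>) (pts h') (\<lambda>p q. c * dst p q) g' \<and>
     g' origin = cls (\<lambda>_. origin)"
proof -
  obtain \<xi> where \<xi>: "\<And>q. q \<in> pts h' \<Longrightarrow> approximates (\<xi> q) q \<and> (q = origin \<longrightarrow> \<xi> q = (\<lambda>_. origin))"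
    using approximates_exists by metis
  have "param (Cone \<mu> Y (\<lambda>n. g (b n)) \<beta>) (pts h') (\<lambda>p q. c * dst p q) (\<lambda>q. cls (\<xi> q))"
  proof (rule param_Cone)
    fix p assume p: "p \<in> bounded_seqs"
    show "\<exists>q\<in>pts h'. ((\<lambda>n. dst (p n) (\<xi> q n) / \<beta> n) \<longlongrightarrow> 0) \<mu>"
    proof (cases "\<exists>q\<in>pts h'. approximates p q")
      case True
      then obtain q where q: "q \<in> pts h'" "approximates p q" by auto
      have "dst q q = 0"
        by (auto simp: dst_def split: prod.splits)
      then show ?thesis
        using approximates_dst[OF q(1) q(1) q(2), of "\<xi> q"] \<xi>[OF q(1)] q(1) by auto
    next
      case False
      then show ?thesis
        using bounded_approximates[OF p] \<xi>[of origin] by (auto simp: dst_origin intro!: bexI[of _ origin])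
    qed
  qed (use \<xi> approximates_bounded approximates_dst in auto)
  then show ?thesis
    using \<xi>[of origin] by auto
qed

end

section \<open>Finding the resonance of an arbitrary scale\<close>

lemma schreier_subset:
  assumes "schreier h F" "G \<subseteq> F"
  shows "schreier h G"
proof -
  have fin: "finite F" using assms by (simp add: schreier_def)
  have "h + enat (card G) \<le> h + enat (card F)"
    using assms(2) fin by (intro add_left_mono) (simp add: card_mono)
  also have "\<dots> \<le> lowest F"
    using assms(1) by (simp add: schreier_def)
  also have "\<dots> \<le> lowest G"
    unfolding lowest_def using assms(2) by (intro INF_superset_mono) auto
  finally show ?thesis
    using fin assms(2) finite_subset by (auto simp: schreier_def)
qed

lemma schreier_card_le: "schreier h F \<Longrightarrow> j \<in> F \<Longrightarrow> card F \<le> j"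
proof -
  assume *: "schreier h F" "j \<in> F"
  have "enat (card F) \<le> h + enat (card F)"
    by (simp add: add_increasing)
  also have "\<dots> \<le> lowest F"
    using * by (simp add: schreier_def)
  also have "\<dots> \<le> enat j"
    unfolding lowest_def using *(2) by (rule INF_lower)
  finally show "card F \<le> j" by simp
qed

text \<open>An element \<open>j\<close> of the limit set bounds the size of \<open>S n\<close> by
  \<open>j\<close>, whereas an infinite limit set would put \<open>Suc j\<close> fixed elements into
  \<open>S n\<close>.\<close>

lemma (in nonprincipal) schreier_limit_finite:
  assumes "eventually (\<lambda>n. schreier h (S n)) \<mu>"
  shows "finite {j. eventually (\<lambda>n. j \<in> S n) \<mu>}"
proof (rule ccontr)
  let ?L = "{j. eventually (\<lambda>n. j \<in> S n) \<mu>}"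
  assume inf: "infinite ?L"
  then obtain j where j: "eventually (\<lambda>n. j \<in> S n) \<mu>"
    using infinite_imp_nonempty by blast
  obtain A where A: "A \<subseteq> ?L" "finite A" "card A = Suc j"
    using infinite_arbitrarily_large[OF inf] by blast
  have "eventually (\<lambda>n. \<forall>i\<in>A. i \<in> S n) \<mu>"
    using A by (intro eventually_ball_finite) auto
  with assms j have "eventually (\<lambda>n. False) \<mu>"
  proof eventually_elim
    case (elim n)
    then have "card A \<le> card (S n)"
      by (intro card_mono) (auto simp: schreier_def)
    then show ?case
      using schreier_card_le[OF elim(1,2)] A by simp
  qed
  then show False by simp
qed

context model_cone
begin

text \<open>The index sets of one visible sequence supply \<open>H\<close>: their pointwise limit is
  finite and is split off, and the rest escapes.\<close>

lemma resonant_if_visible: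
  assumes p: "p \<in> bounded_seqs" and \<epsilon>: "0 < \<epsilon>" "eventually (\<lambda>n. \<epsilon> \<le> rad (fst (p n)) / \<beta> n) \<mu>"
  shows "\<exists>H h' c. resonant_cone \<mu> Y h g b \<beta> H h' c"
proof -
  obtain K where K: "eventually (\<lambda>n. rad (fst (p n)) \<le> K * \<beta> n) \<mu>" and range: "range p \<subseteq> pts h"
    using p by (auto simp: bounded_seqs_iff)
  define S where "S n = (case fst (p n) of None \<Rightarrow> {} | Some F \<Rightarrow> F)" for n
  have tag: "eventually (\<lambda>n. fst (p n) = Some (S n)) \<mu>"
    using \<epsilon>(2)
  proof eventually_elim
    case (elim n)
    then show ?case
      using \<epsilon>(1) by (cases "fst (p n)") (auto simp: S_def)
  qed
  have S: "eventually (\<lambda>n. schreier h (S n)) \<mu>"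
    using tag
  proof eventually_elim
    case (elim n)
    have "p n \<in> pts h" using range by auto
    then show ?case
      using elim by (cases rule: pts_cases) (auto simp: origin_def)
  qed
  define L where "L = {j. eventually (\<lambda>n. j \<in> S n) \<mu>}"
  have fin: "finite L"
    unfolding L_def using S by (rule schreier_limit_finite)
  define H where "H n = S n - L" for n
  have "eventually (\<lambda>n. \<forall>j\<in>L. j \<in> S n) \<mu>"
    using fin by (intro eventually_ball_finite) (auto simp: L_def)
  with tag S have rad_eq: "eventually (\<lambda>n. rad (fst (p n)) = prod wt (H n) * prod wt L) \<mu>"
  proof eventually_elim
    case (elim n)
    have "prod wt (S n) = prod wt (S n - L) * prod wt L"
      using elim by (intro prod.subset_diff) (auto simp: schreier_def)
    then show ?case
      using elim by (simp add: H_def)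
  qed
  have "eventually (\<lambda>n. prod wt (H n) / \<beta> n \<le> K) \<mu>"
    using K rad_eq
  proof eventually_elim
    case (elim n)
    have "prod wt (H n) * 1 \<le> prod wt (H n) * prod wt L"
      by (intro mult_left_mono prod_wt_ge_1) simp
    also have "\<dots> \<le> K * \<beta> n"
      using elim by simp
    finally show ?case
      by (simp add: pos_divide_le_eq scale_pos)
  qed
  then obtain c where c: "((\<lambda>n. prod wt (H n) / \<beta> n) \<longlongrightarrow> c) \<mu>"
    using bounded_has_limit[of "\<lambda>n. prod wt (H n) / \<beta> n" K] scale_pos by (auto simp: less_imp_le)
  have "eventually (\<lambda>n. \<epsilon> / prod wt L \<le> prod wt (H n) / \<beta> n) \<mu>"
    using \<epsilon>(2) rad_eq by eventually_elim (simp add: pos_divide_le_eq mult.commute)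
  then have "\<epsilon> / prod wt L \<le> c"
    using c by (intro tendsto_lowerbound[of _ c \<mu>]) auto
  then have "0 < c"
    by (rule less_le_trans[rotated]) (use \<epsilon>(1) in simp)
  obtain h' where h': "enat_tends \<mu> (\<lambda>n. h + enat (card (H n))) h'"
    using enat_tends_exists by blast
  have "resonant_cone \<mu> Y h g b \<beta> H h' c"
  proof
    show "eventually (\<lambda>n. j \<notin> H n) \<mu>" for j
    proof (cases "j \<in> L")
      case False
      then have "eventually (\<lambda>n. j \<notin> S n) \<mu>"
        by (simp add: L_def eventually_not_iff)
      then show ?thesis
        by eventually_elim (simp add: H_def)
    qed (simp add: H_def)
    show "eventually (\<lambda>n. schreier h (H n)) \<mu>"
      using S by eventually_elim (auto simp: H_def intro: schreier_subset)
  qed fact+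
  then show ?thesis by blast
qed

text \<open>If all bounded sequences have negligible radius, the cone is a single point; otherwise a
  visible one produces a resonance.\<close>

lemma Cone_dichotomy:
  "finite (mspace (Cone \<mu> Y (\<lambda>n. g (b n)) \<beta>)) \<or>
   (\<exists>h' c g'. 0 < c \<and> param (Cone \<mu> Y (\<lambda>n. g (b n)) \<beta>) (pts h') (\<lambda>p q. c * dst p q) g')"
proof (cases "\<forall>p\<in>bounded_seqs. ((\<lambda>n. rad (fst (p n)) / \<beta> n) \<longlongrightarrow> 0) \<mu>")
  case True
  have "mspace (Cone \<mu> Y (\<lambda>n. g (b n)) \<beta>) \<subseteq> {cls (\<lambda>_. origin)}"
  proof
    fix C assume "C \<in> mspace (Cone \<mu> Y (\<lambda>n. g (b n)) \<beta>)"
    then obtain p where "p \<in> bounded_seqs" "C = cls p"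
      by (auto simp: mspace_Cone_eq)
    then show "C \<in> {cls (\<lambda>_. origin)}"
      using True cls_eqI[OF _ origin_bounded, of p] by (simp add: dst_origin)
  qed
  then show ?thesis
    using finite_subset by blast
next
  case False
  then obtain p where p: "p \<in> bounded_seqs" "\<not> ((\<lambda>n. rad (fst (p n)) / \<beta> n) \<longlongrightarrow> 0) \<mu>"
    by auto
  then obtain \<epsilon> where "\<epsilon> > 0" "eventually (\<lambda>n. \<epsilon> \<le> rad (fst (p n)) / \<beta> n) \<mu>"
    using tendsto_0_or_bounded_below[of "\<lambda>n. rad (fst (p n)) / \<beta> n"] scale_pos
    by (auto simp: less_imp_le)
  then obtain H h' c where "resonant_cone \<mu> Y h g b \<beta> H h' c"
    using resonant_if_visible[OF p(1)] by blast
  then interpret resonant_cone \<mu> Y h g b \<beta> H h' c .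
  show ?thesis
    using param_resonant_cone c_pos by blast
qed

end

text \<open>
  If the base point escapes faster than the scale, the cone only sees a blow-up of a single piece.
\<close>

locale escaping_cone = cone_data \<mu> Y "pts h" dst g b \<beta>
  for \<mu> and Y :: "'a metric" and h :: enat and g :: "pt \<Rightarrow> 'a" and b \<beta> +
  assumes base_escapes: "\<And>K. eventually (\<lambda>n. K * \<beta> n < rad (fst (b n))) \<mu>"
begin

text \<open>Within the piece of the base point, distances divided by the scale are coordinate
  differences magnified by this factor.\<close>

definition blowup :: "nat \<Rightarrow> real" where
  "blowup n = rad (fst (b n)) / \<beta> n"

lemma blowup_nonneg: "0 \<le> blowup n"
  using scale_pos[of n] by (simp add: blowup_def)

lemma inverse_blowup_tendsto_0: "((\<lambda>n. 1 / blowup n) \<longlongrightarrow> 0) \<mu>"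
proof -
  have "filterlim blowup at_top \<mu>"
    unfolding filterlim_at_top
  proof
    fix K show "eventually (\<lambda>n. K \<le> blowup n) \<mu>"
      using base_escapes[of K]
      by eventually_elim (use scale_pos in \<open>auto simp: blowup_def pos_le_divide_eq less_imp_le\<close>)
  qed
  then show ?thesis
    by (intro tendsto_divide_0[OF tendsto_const] filterlim_at_top_imp_at_infinity)
qed

text \<open>A different tag would force a distance of at least the radius of the base point, which
  eventually exceeds every multiple of the scale.\<close>

lemma bounded_seqs_near:
  assumes "p \<in> bounded_seqs"
  shows "eventually (\<lambda>n. fst (p n) = fst (b n)) \<mu>"
    and "\<exists>K\<ge>0. eventually (\<lambda>n. \<bar>fst (snd (p n)) - fst (snd (b n))\<bar> * blowup n \<le> K \<and>
      \<bar>snd (snd (p n)) - snd (snd (b n))\<bar> * blowup n \<le> K) \<mu>"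
proof -
  obtain K where K: "eventually (\<lambda>n. dst (p n) (b n) \<le> K * \<beta> n) \<mu>"
    using assms by (auto simp: bounded_seqs_def)
  with base_escapes[of K] show tag: "eventually (\<lambda>n. fst (p n) = fst (b n)) \<mu>"
    by eventually_elim (auto simp: dst_def split: prod.splits if_splits)
  have "eventually (\<lambda>n. \<bar>fst (snd (p n)) - fst (snd (b n))\<bar> * blowup n \<le> max K 0 \<and>
      \<bar>snd (snd (p n)) - snd (snd (b n))\<bar> * blowup n \<le> max K 0) \<mu>"
    using K tag
  proof eventually_elim
    case (elim n)
    let ?x = "\<bar>fst (snd (p n)) - fst (snd (b n))\<bar>" and ?y = "\<bar>snd (snd (p n)) - snd (snd (b n))\<bar>"
    have "max ?x ?y * blowup n = dst (p n) (b n) / \<beta> n"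
      using elim(2) by (auto simp: dst_def blowup_def split: prod.splits)
    also have "\<dots> \<le> K"
      using elim(1) scale_pos[of n] by (simp add: pos_divide_le_eq)
    finally have "max ?x ?y * blowup n \<le> K" .
    moreover have "?x * blowup n \<le> max ?x ?y * blowup n" "?y * blowup n \<le> max ?x ?y * blowup n"
      using blowup_nonneg by (intro mult_right_mono; simp)+
    ultimately show ?case by linarith
  qed
  then show "\<exists>K\<ge>0. eventually (\<lambda>n. \<bar>fst (snd (p n)) - fst (snd (b n))\<bar> * blowup n \<le> K \<and>
      \<bar>snd (snd (p n)) - snd (snd (b n))\<bar> * blowup n \<le> K) \<mu>"
    by (intro exI[of _ "max K 0"]) auto
qed

definition near :: "(nat \<Rightarrow> real) \<Rightarrow> (nat \<Rightarrow> real) \<Rightarrow> bool" where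
  "near u v \<longleftrightarrow> ((\<lambda>n. (u n - v n) * blowup n) \<longlongrightarrow> 0) \<mu>"

lemma near_refl: "near u u"
  by (simp add: near_def)

lemma near_sym: "near u v \<Longrightarrow> near v u"
  using tendsto_minus[of "\<lambda>n. (u n - v n) * blowup n" 0 \<mu>] by (simp add: near_def algebra_simps)

lemma near_trans: "near u v \<Longrightarrow> near v w \<Longrightarrow> near u w"
  using tendsto_add[of "\<lambda>n. (u n - v n) * blowup n" 0 \<mu> "\<lambda>n. (v n - w n) * blowup n" 0]
  by (simp add: near_def algebra_simps)

text \<open>Magnifying a bound quadratic in \<open>1 / blowup n\<close> leaves a linear one, which
  vanishes.\<close>

lemma near_if_square_small:
  assumes "eventually (\<lambda>n. \<bar>u n - v n\<bar> \<le> 2 * (K / blowup n)\<^sup>2) \<mu>"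
  shows "near u v"
  unfolding near_def
proof (rule tendsto_0_le[of "\<lambda>n. 1 / blowup n" \<mu> _ "2 * K\<^sup>2"])
  show "((\<lambda>n. 1 / blowup n) \<longlongrightarrow> 0) \<mu>"
    by (rule inverse_blowup_tendsto_0)
  show "eventually (\<lambda>n. norm ((u n - v n) * blowup n) \<le> norm (1 / blowup n) * (2 * K\<^sup>2)) \<mu>"
    using assms
  proof eventually_elim
    case (elim n)
    have "\<bar>u n - v n\<bar> * blowup n \<le> 2 * (K / blowup n)\<^sup>2 * blowup n"
      using elim blowup_nonneg by (intro mult_right_mono)
    also have "\<dots> = 1 / blowup n * (2 * K\<^sup>2)"
      by (simp add: power2_eq_square)
    finally show ?case
      using blowup_nonneg[of n] by (simp add: abs_mult)
  qed
qed

text \<open>All three lie within \<open>K / blowup n\<close> of one another, so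
  \<open>seq_pts_three\<close> makes some pair quadratically close for \<open>\<mu>\<close>-almost
  every \<open>n\<close>; the ultrafilter fixes which pair.\<close>

lemma near_three:
  assumes "\<And>n. u n \<in> seq_pts \<infinity>" "\<And>n. v n \<in> seq_pts \<infinity>" "\<And>n. w n \<in> seq_pts \<infinity>"
    and "eventually (\<lambda>n. \<bar>u n - z n\<bar> * blowup n \<le> K1) \<mu>" "eventually (\<lambda>n. \<bar>v n - z n\<bar> * blowup n \<le> K2) \<mu>"
      "eventually (\<lambda>n. \<bar>w n - z n\<bar> * blowup n \<le> K3) \<mu>"
    and "0 \<le> K1" "0 \<le> K2" "0 \<le> K3"
  shows "near u v \<or> near v w \<or> near u w"
proof -
  define K where "K = K1 + K2 + K3"
  have "eventually (\<lambda>n. 0 < blowup n) \<mu>"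
    using base_escapes[of 0] by eventually_elim (simp add: blowup_def scale_pos)
  with assms(4-6) have "eventually (\<lambda>n. \<bar>u n - v n\<bar> \<le> 2 * (K / blowup n)\<^sup>2 \<or>
      \<bar>v n - w n\<bar> \<le> 2 * (K / blowup n)\<^sup>2 \<or> \<bar>u n - w n\<bar> \<le> 2 * (K / blowup n)\<^sup>2) \<mu>"
  proof eventually_elim
    case (elim n)
    have tri: "\<bar>a - c\<bar> \<le> K / blowup n"
      if "\<bar>a - z n\<bar> * blowup n \<le> A" "\<bar>c - z n\<bar> * blowup n \<le> C" "A + C \<le> K" for a c A C
    proof -
      have "\<bar>a - c\<bar> * blowup n \<le> (\<bar>a - z n\<bar> + \<bar>c - z n\<bar>) * blowup n"
        using elim(4) by (intro mult_right_mono) auto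
      also have "\<dots> \<le> K"
        using that by (simp add: algebra_simps)
      finally show ?thesis
        using elim(4) by (simp add: pos_le_divide_eq)
    qed
    show ?case
      by (rule seq_pts_three[OF assms(1,2,3)]; rule tri; (rule elim)?) (use assms(7-9) in \<open>simp_all add: K_def\<close>)
  qed
  then show ?thesis
    using near_if_square_small by (auto simp: eventually_disj_iff)
qed

lemma cls_eq_if_near:
  assumes p: "p \<in> bounded_seqs" and q: "q \<in> bounded_seqs"
    and "near (\<lambda>n. fst (snd (p n))) (\<lambda>n. fst (snd (q n)))" "near (\<lambda>n. snd (snd (p n))) (\<lambda>n. snd (snd (q n)))"
  shows "cls p = cls q"
proof (rule cls_eqI[OF p q])
  have "((\<lambda>n. max \<bar>(fst (snd (p n)) - fst (snd (q n))) * blowup n\<bar> \<bar>(snd (snd (p n)) - snd (snd (q n))) * blowup n\<bar>)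
      \<longlongrightarrow> max \<bar>0\<bar> \<bar>0\<bar>) \<mu>"
    using assms(3,4) unfolding near_def by (intro tendsto_intros)
  moreover have "eventually (\<lambda>n. max \<bar>(fst (snd (p n)) - fst (snd (q n))) * blowup n\<bar> \<bar>(snd (snd (p n)) - snd (snd (q n))) * blowup n\<bar>
      = dst (p n) (q n) / \<beta> n) \<mu>"
    using bounded_seqs_near(1)[OF p] bounded_seqs_near(1)[OF q]
  proof eventually_elim
    case (elim n)
    have "max \<bar>x * blowup n\<bar> \<bar>y * blowup n\<bar> = blowup n * max \<bar>x\<bar> \<bar>y\<bar>" for x y
      using blowup_nonneg[of n] by (auto simp: abs_mult max_mult_distrib_left mult.commute)
    then show ?case
      using elim by (auto simp: dst_def blowup_def split: prod.splits)
  qed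
  ultimately show "((\<lambda>n. dst (p n) (q n) / \<beta> n) \<longlongrightarrow> 0) \<mu>"
    by (simp add: Lim_transform_eventually)
qed

text \<open>Each coordinate takes at most two values up to \<open>near\<close>, so the cone has at
  most four points.\<close>

theorem finite_escaping_cone: "finite (mspace (Cone \<mu> Y (\<lambda>n. g (b n)) \<beta>))"
proof -
  let ?M = "mspace (Cone \<mu> Y (\<lambda>n. g (b n)) \<beta>)"
  have "\<forall>C\<in>?M. \<exists>p. p \<in> bounded_seqs \<and> cls p = C"
    by (auto simp: mspace_Cone_eq)
  then obtain \<sigma> where \<sigma>: "\<And>C. C \<in> ?M \<Longrightarrow> \<sigma> C \<in> bounded_seqs \<and> cls (\<sigma> C) = C"
    by metis
  have coords: "fst (snd (\<sigma> C n)) \<in> seq_pts \<infinity> \<and> snd (snd (\<sigma> C n)) \<in> seq_pts \<infinity>" if "C \<in> ?M" for C n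
    using \<sigma>[OF that] pts_coords[of "fst (\<sigma> C n)" "fst (snd (\<sigma> C n))" "snd (snd (\<sigma> C n))" h]
    by (auto simp: bounded_seqs_def)
  let ?r = "\<lambda>\<phi>. {(C, D) \<in> ?M \<times> ?M. near (\<lambda>n. \<phi> (snd (\<sigma> C n))) (\<lambda>n. \<phi> (snd (\<sigma> D n)))}"
  have eqv: "equiv ?M (?r \<phi>)" for \<phi> :: "real \<times> real \<Rightarrow> real"
    by (rule equivI) (auto simp: refl_on_def sym_def trans_def intro: near_refl near_sym near_trans)
  show ?thesis
  proof (rule finite_of_two_relations[OF eqv[of fst] _ eqv[of snd]])
    fix C D E assume *: "C \<in> ?M" "D \<in> ?M" "E \<in> ?M"
    obtain K1 K2 K3 where K: "0 \<le> K1" "0 \<le> K2" "0 \<le> K3"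
      "eventually (\<lambda>n. \<bar>fst (snd (\<sigma> C n)) - fst (snd (b n))\<bar> * blowup n \<le> K1 \<and>
        \<bar>snd (snd (\<sigma> C n)) - snd (snd (b n))\<bar> * blowup n \<le> K1) \<mu>"
      "eventually (\<lambda>n. \<bar>fst (snd (\<sigma> D n)) - fst (snd (b n))\<bar> * blowup n \<le> K2 \<and>
        \<bar>snd (snd (\<sigma> D n)) - snd (snd (b n))\<bar> * blowup n \<le> K2) \<mu>"
      "eventually (\<lambda>n. \<bar>fst (snd (\<sigma> E n)) - fst (snd (b n))\<bar> * blowup n \<le> K3 \<and>
        \<bar>snd (snd (\<sigma> E n)) - snd (snd (b n))\<bar> * blowup n \<le> K3) \<mu>"
      using bounded_seqs_near(2) \<sigma> * by meson
    show "(C, D) \<in> ?r fst \<or> (D, E) \<in> ?r fst \<or> (C, E) \<in> ?r fst"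
      using near_three[of "\<lambda>n. fst (snd (\<sigma> C n))" "\<lambda>n. fst (snd (\<sigma> D n))" "\<lambda>n. fst (snd (\<sigma> E n))"
          "\<lambda>n. fst (snd (b n))" K1 K2 K3] K coords * by (simp add: eventually_conj_iff)
    show "(C, D) \<in> ?r snd \<or> (D, E) \<in> ?r snd \<or> (C, E) \<in> ?r snd"
      using near_three[of "\<lambda>n. snd (snd (\<sigma> C n))" "\<lambda>n. snd (snd (\<sigma> D n))" "\<lambda>n. snd (snd (\<sigma> E n))"
          "\<lambda>n. snd (snd (b n))" K1 K2 K3] K coords * by (simp add: eventually_conj_iff)
  next
    fix C D assume "(C, D) \<in> ?r fst" "(C, D) \<in> ?r snd"
    then show "C = D"
      using cls_eq_if_near[of "\<sigma> C" "\<sigma> D"] \<sigma>[of C] \<sigma>[of D] by auto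
  qed
qed

end

section \<open>Counting the cones\<close>

text \<open>Along an ultrafilter, a base point not within a bounded multiple of the scale exceeds
  every multiple of it, so the two kinds of cones cover all cases.\<close>

lemma Cone_of_model:
  fixes Y :: "'a metric"
  assumes Y: "param Y (pts h) dst g" and C: "C \<in> asymptotic_cones Y"
  shows "finite (mspace C) \<or> (\<exists>h' c g'. 0 < c \<and> param C (pts h') (\<lambda>p q. c * dst p q) g')"
proof -
  obtain \<mu> e \<beta> where C: "C = Cone \<mu> Y e \<beta>" and \<mu>: "nonprincipal_ultrafilter \<mu>"
    and e: "range e \<subseteq> mspace Y" and \<beta>: "scaling_factor_along \<mu> \<beta>"
    using C by (auto simp: asymptotic_cones_def)
  have "\<exists>p\<in>pts h. e n = g p" for n
  proof -
    have "e n \<in> g ` pts h"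
      using e Y by (auto simp: param_def)
    then show ?thesis by blast
  qed
  then obtain b where b: "\<And>n. b n \<in> pts h" "\<And>n. e n = g (b n)"
    by metis
  then have e_eq: "e = (\<lambda>n. g (b n))" by auto
  interpret cone_data \<mu> Y "pts h" dst g b \<beta>
    using \<mu> Y b(1) \<beta> by unfold_locales (auto simp: scaling_factor_along_def)
  show ?thesis
  proof (cases "\<exists>K. eventually (\<lambda>n. rad (fst (b n)) \<le> K * \<beta> n) \<mu>")
    case True
    then interpret model_cone \<mu> Y h g b \<beta>
      by unfold_locales
    show ?thesis
      using Cone_dichotomy by (simp add: C e_eq)
  next
    case False
    interpret escaping_cone \<mu> Y h g b \<beta>
    proof
      fix K
      have "eventually (\<lambda>n. \<not> rad (fst (b n)) \<le> K * \<beta> n) \<mu>"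
        using False by (simp add: eventually_not_iff)
      then show "eventually (\<lambda>n. K * \<beta> n < rad (fst (b n))) \<mu>"
        by eventually_elim simp
    qed
    show ?thesis
      using finite_escaping_cone by (simp add: C e_eq)
  qed
qed

text \<open>As \<open>I\<close> is a relation, no canonical key is required; one member is picked
  for each key.\<close>

lemma countable_quotient_by_invariant:
  fixes I :: "'a \<Rightarrow> 'k::countable \<Rightarrow> bool"
  assumes "\<And>x. x \<in> A \<Longrightarrow> \<exists>k. I x k" "\<And>x y k. I x k \<Longrightarrow> I y k \<Longrightarrow> r `` {x} = r `` {y}"
  shows "countable (A // r)"
proof -
  have "A // r \<subseteq> (\<lambda>k. r `` {SOME x. I x k}) ` UNIV"
  proof
    fix Q assume "Q \<in> A // r"
    then obtain x where x: "x \<in> A" "Q = r `` {x}" by (auto elim: quotientE)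
    then obtain k where k: "I x k" using assms(1) by blast
    then have "I (SOME x. I x k) k" by (rule someI)
    then have "Q = r `` {SOME x. I x k}" using assms(2) k x by blast
    then show "Q \<in> (\<lambda>k. r `` {SOME x. I x k}) ` UNIV" by blast
  qed
  then show ?thesis
    by (rule countable_subset) simp
qed

lemma countable_asymptotic_cones:
  fixes Y :: "'a metric"
  assumes "param Y (pts h) dst g"
  shows "countable (asymptotic_cones Y // homeomorphism_rel)"
proof (rule countable_quotient_by_invariant)
  \<comment> \<open>Finite cones are classified by their number of points, the others by the index
    of the model. The factor \<open>c\<close> is left out of the key because rescaling preserves the
    topology.\<close>
  define I :: "(nat \<Rightarrow> 'a) set metric \<Rightarrow> nat + enat \<Rightarrow> bool" where
    "I C k = (case k of Inl m \<Rightarrow> finite (mspace C) \<and> card (mspace C) = m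
      | Inr h \<Rightarrow> (\<exists>c g'. 0 < c \<and> param C (pts h) (\<lambda>p q. c * dst p q) g'))" for C k
  show "\<exists>k. I C k" if "C \<in> asymptotic_cones Y" for C
    using Cone_of_model[OF assms that]
  proof
    assume "finite (mspace C)"
    then show ?thesis by (intro exI[of _ "Inl (card (mspace C))"]) (simp add: I_def)
  next
    assume "\<exists>h' c g'. 0 < c \<and> param C (pts h') (\<lambda>p q. c * dst p q) g'"
    then obtain h' where "\<exists>c g'. 0 < c \<and> param C (pts h') (\<lambda>p q. c * dst p q) g'" by blast
    then show ?thesis by (intro exI[of _ "Inr h'"]) (simp add: I_def)
  qed
  show "homeomorphism_rel `` {C} = homeomorphism_rel `` {D}" if C: "I C k" and D: "I D k" for C D k
  proof -
    have "mtopology_of C homeomorphic_space mtopology_of D"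
    proof (cases k)
      case (Inl m)
      then show ?thesis
        using C D by (intro finite_homeomorphic) (auto simp: I_def)
    next
      case (Inr h')
      obtain c g' where "0 < c" "param C (pts h') (\<lambda>p q. c * dst p q) g'"
        using C Inr by (auto simp: I_def)
      moreover obtain d g'' where "0 < d" "param D (pts h') (\<lambda>p q. d * dst p q) g''"
        using D Inr by (auto simp: I_def)
      ultimately show ?thesis
        by (intro param_homeomorphic)
    qed
    then show ?thesis
      by (auto simp: homeomorphism_rel_def) (meson homeomorphic_space_sym homeomorphic_space_trans)+
  qed
qed

section \<open>The iterated cones\<close>

text \<open>At scale \<open>wt n\<close> the singleton \<open>{n}\<close> resonates with radius
  equal to the scale. Hence \<open>c = 1\<close>, no rescaling accumulates, and each cone raises the
  index by one.\<close>

lemma iterated_cone_param: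
  fixes X :: "'a metric"
  assumes \<mu>: "nonprincipal_ultrafilter \<mu>" and X: "param X (pts 0) dst g0"
  shows "\<exists>g. param (fst (iterated_cone_pointed \<mu> X (g0 origin) wt i)) (pts (enat i)) dst g \<and>
    snd (iterated_cone_pointed \<mu> X (g0 origin) wt i) = g origin"
proof (induction i)
  case 0
  have "param (relabel Pt X) (pts 0) dst (Pt \<circ> g0)"
    using X by (rule param_relabel) (simp add: inj_on_def)
  then show ?case
    by (intro exI[of _ "Pt \<circ> g0"]) (simp add: zero_enat_def o_def)
next
  case (Suc i)
  obtain Y p where Yp: "iterated_cone_pointed \<mu> X (g0 origin) wt i = (Y, p)"
    by fastforce
  then obtain g where g: "param Y (pts (enat i)) dst g" and p: "p = g origin"
    using Suc by auto
  interpret cone_data \<mu> Y "pts (enat i)" dst g "\<lambda>_. origin" wt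
    using \<mu> g by unfold_locales auto
  interpret resonant_cone \<mu> Y "enat i" g "\<lambda>_. origin" wt "\<lambda>n. {n}" "enat (Suc i)" 1
  proof
    show "\<exists>K. eventually (\<lambda>n. rad (fst origin) \<le> K * wt n) \<mu>"
      by (intro exI[of _ 0]) simp
    show "eventually (\<lambda>n. j \<notin> {n}) \<mu>" for j
      using eventually_ge[of "Suc j"] by eventually_elim auto
    \<comment> \<open>For \<open>{n}\<close> the condition reads
      \<open>i + 1 \<le> n\<close>.\<close>
    show "eventually (\<lambda>n. schreier (enat i) {n}) \<mu>"
      using eventually_ge[of "Suc i"] by eventually_elim (simp add: schreier_def lowest_def)
    show "enat_tends \<mu> (\<lambda>n. enat i + enat (card {n})) (enat (Suc i))"
      by (simp add: enat_tends_def)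
    show "((\<lambda>n. prod wt {n} / wt n) \<longlongrightarrow> 1) \<mu>"
      using wt_pos by (simp add: less_imp_neq[symmetric])
  qed simp
  obtain g' where g': "param (Cone \<mu> Y (\<lambda>n. g origin) wt) (pts (enat (Suc i))) dst g'"
    "g' origin = cls (\<lambda>_. origin)"
    using param_resonant_cone by auto
  have "param (relabel name (Cone \<mu> Y (\<lambda>n. p) wt)) (pts (enat (Suc i))) dst (name \<circ> g')"
    unfolding p by (rule param_relabel[OF g'(1) inj_on_name[OF \<mu> wt_pos range_base]])
  then show ?case
    using g'(2) by (intro exI[of _ "name \<circ> g'"]) (simp add: Yp cls_def p o_def)
qed

section \<open>Non-isolated points of the models\<close>

lemma schreier_empty: "schreier h {}"
  by (simp add: schreier_def lowest_def top_enat_def)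

lemma lowest_eq_infinity: "lowest F = \<infinity> \<longleftrightarrow> F = {}"
  using INF_lower[of _ F enat] by (auto simp: lowest_def top_enat_def)

text \<open>Coordinates accumulate only at 0. At finite index the first is never 0, and the second
  is 0 only in the piece of the empty set, where it is not truncated.\<close>

lemma pts_isolated:
  assumes p: "p \<in> pts (enat i)" and np: "p \<notin> (\<lambda>x. (Some {}, x, 0)) ` seq_pts (enat i)"
  shows "\<exists>r>0. \<forall>q\<in>pts (enat i). q \<noteq> p \<longrightarrow> r \<le> dst p q"
  using p
proof (cases rule: pts_cases)
  case 1
  have "1 \<le> dst p q" if "q \<in> pts (enat i)" "q \<noteq> p" for q
    using that(1) by (cases rule: pts_cases) (use that 1 prod_wt_ge_1 in \<open>auto simp: dst_origin\<close>)
  then show ?thesis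
    by (intro exI[of _ 1]) auto
next
  case (2 F x y)
  obtain a where a: "1 \<le> a" "x = dlt a"
    using 2(3) by (auto elim!: seq_pts_cases)
  have "y \<noteq> 0"
    using np 2 by (auto simp: zero_in_seq_pts lowest_eq_infinity)
  then obtain k where k: "1 \<le> k" "y = dlt k"
    using 2(4) by (auto elim!: seq_pts_cases)
  \<comment> \<open>Half-gaps of the two coordinates; all radii are at least 1, so scaling does not
    shrink them.\<close>
  define r where "r = min (dlt a / 2) (dlt k / 2)"
  have "r \<le> dst p q" if q: "q \<in> pts (enat i)" "q \<noteq> p" for q
  proof (cases "fst q = Some F")
    case False
    have "r \<le> 1"
      using dlt_le[OF a(1)] by (simp add: r_def)
    also have "\<dots> \<le> prod wt F"
      by (rule prod_wt_ge_1)
    also have "\<dots> \<le> dst p q"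
      using False by (auto simp: dst_def 2(1) split: prod.splits)
    finally show ?thesis .
  next
    case True
    then obtain x' y' where q': "q = (Some F, x', y')"
      by (metis prod.collapse)
    have xy: "x' \<in> seq_pts \<infinity>" "y' \<in> seq_pts \<infinity>"
      using pts_coords[of "Some F" x' y'] q q' by auto
    have "x' \<noteq> x \<or> y' \<noteq> y"
      using q q' 2(1) by auto
    then have "r \<le> max \<bar>x - x'\<bar> \<bar>y - y'\<bar>"
      using seq_pts_gap[OF a(1) xy(1)] seq_pts_gap[OF k(1) xy(2)] a k
      by (auto simp: r_def abs_minus_commute min_le_iff_disj le_max_iff_disj)
    also have "\<dots> \<le> prod wt F * max \<bar>x - x'\<bar> \<bar>y - y'\<bar>"
      using mult_right_mono[OF prod_wt_ge_1, of "max \<bar>x - x'\<bar> \<bar>y - y'\<bar>" F] by (simp add: le_max_iff_disj)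
    also have "\<dots> = dst p q"
      by (simp add: dst_def 2(1) q')
    finally show ?thesis .
  qed
  then show ?thesis
    by (intro exI[of _ r]) (auto simp: r_def)
qed

text \<open>The piece of the empty set has radius 1 and an untruncated second coordinate, so
  \<open>dlt\<close> itself supplies the approximating points.\<close>

lemma pts_limit:
  assumes x: "x \<in> seq_pts (enat i)" and "0 < r"
  shows "\<exists>q\<in>pts (enat i). q \<noteq> (Some {}, x, 0) \<and> dst (Some {}, x, 0) q < r"
proof -
  obtain k where "\<forall>l\<ge>k. dlt l < r"
    using order_tendstoD(2)[OF dlt_tendsto_0 assms(2)] by (auto simp: eventually_sequentially)
  then have "dlt (Suc k) < r" by simp
  moreover have "(Some {}, x, dlt (Suc k)) \<in> pts (enat i)"
    using x by (auto simp: pts_def schreier_empty dlt_in_seq_pts lowest_eq_infinity[THEN iffD2])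
  ultimately show ?thesis
    by (intro bexI[of _ "(Some {}, x, dlt (Suc k))"]) (auto simp: dst_def dlt_def)
qed

text \<open>The non-isolated points are the limits \<open>y = 0\<close> in the piece of the empty
  set, one for each of the \<open>i\<close> values of \<open>x\<close>.\<close>

lemma card_derived_set:
  assumes Y: "param Y (pts (enat i)) dst g"
  shows "card (mtopology_of Y derived_set_of mspace Y) = i"
proof -
  let ?A = "(\<lambda>x. (Some {}, x, 0)) ` seq_pts (enat i) :: pt set"
  have M: "mspace Y = g ` pts (enat i)"
    using Y by (simp add: param_def)
  have eq: "g p = g q \<longleftrightarrow> p = q" if "p \<in> pts (enat i)" "q \<in> pts (enat i)" for p q
    using param_eq_iff[OF Y that] Metric_space.zero[OF Metric_space_pts that] by simp
  have A: "?A \<subseteq> pts (enat i)"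
    by (auto simp: pts_def schreier_empty zero_in_seq_pts lowest_eq_infinity)
  have "mtopology_of Y derived_set_of mspace Y =
      {x \<in> mspace Y. \<forall>r>0. \<exists>y\<in>mspace Y. y \<noteq> x \<and> y \<in> Metric_space.mball (mspace Y) (mdist Y) x r}"
    unfolding mtopology_of_def by (rule Metric_space.metric_derived_set_of) simp
  also have "\<dots> = {x \<in> mspace Y. \<forall>r>0. \<exists>y\<in>mspace Y. y \<noteq> x \<and> mdist Y x y < r}"
    by (auto simp: Metric_space.in_mball[OF Metric_space_mspace_mdist])
  also have "\<dots> = g ` {p \<in> pts (enat i). \<forall>r>0. \<exists>q\<in>pts (enat i). q \<noteq> p \<and> dst p q < r}"
    by (auto simp: M param_mdist[OF Y] eq)
  also have "{p \<in> pts (enat i). \<forall>r>0. \<exists>q\<in>pts (enat i). q \<noteq> p \<and> dst p q < r} = ?A"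
  proof (intro equalityI subsetI)
    fix p assume p: "p \<in> {p \<in> pts (enat i). \<forall>r>0. \<exists>q\<in>pts (enat i). q \<noteq> p \<and> dst p q < r}"
    show "p \<in> ?A"
    proof (rule ccontr)
      assume "p \<notin> ?A"
      then obtain r where "r > 0" "\<forall>q\<in>pts (enat i). q \<noteq> p \<longrightarrow> r \<le> dst p q"
        using pts_isolated p by blast
      then show False
        using p by (auto simp: not_less[symmetric])
    qed
  next
    fix p assume "p \<in> ?A"
    then show "p \<in> {p \<in> pts (enat i). \<forall>r>0. \<exists>q\<in>pts (enat i). q \<noteq> p \<and> dst p q < r}"
      using A pts_limit by auto
  qed
  finally have "mtopology_of Y derived_set_of mspace Y = g ` ?A" .
  moreover have "inj_on g ?A"
    using A eq by (meson inj_onI subsetD)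
  moreover have "card ?A = i"
    by (simp add: card_image inj_on_def card_seq_pts)
  ultimately show ?thesis
    by (simp add: card_image)
qed

lemma homeomorphic_card_derived_set:
  assumes "S homeomorphic_space T"
  shows "card (S derived_set_of topspace S) = card (T derived_set_of topspace T)"
proof -
  obtain f where f: "homeomorphic_map S T f"
    using assms by (auto simp: homeomorphic_space)
  have "T derived_set_of topspace T = f ` (S derived_set_of topspace S)"
    using homeomorphic_map_derived_set_of[OF f subset_refl] homeomorphic_imp_surjective_map[OF f] by simp
  moreover have "inj_on f (S derived_set_of topspace S)"
    by (rule inj_on_subset[OF homeomorphic_imp_injective_map[OF f] derived_set_of_subset_topspace])
  ultimately show ?thesis
    by (simp add: card_image)
qed

lemma scaling_factor_wt: "scaling_factor wt"
proof -
  have "eventually (\<lambda>n. real n \<le> wt n) sequentially"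
  proof (rule always_eventually, rule allI)
    fix n
    have "real n * 1 \<le> prod wt {..<n} * prod wt {..<n}"
      by (intro mult_mono le_prod_wt_lessThan prod_wt_ge_1) auto
    then show "real n \<le> wt n"
      using prod_wt_lessThan_square_le[of n] by (simp add: power2_eq_square)
  qed
  then show ?thesis
    unfolding scaling_factor_def using filterlim_at_top_mono[OF filterlim_real_sequentially] by auto
qed

text \<open>A numbering of the countable model moves it to a concrete type; its metric is unrelated
  to that of the reals.\<close>

lemma model_in_real: "\<exists>(X :: real metric) g. param X (pts 0) dst g"
proof -
  define f :: "pt \<Rightarrow> real" where "f p = real (to_nat_on (pts 0) p)" for p
  let ?M = "metric (pts 0, dst)"
  have M: "mspace ?M = pts 0" "mdist ?M = dst"
    using Metric_space.mspace_metric[OF Metric_space_pts] Metric_space.mdist_metric[OF Metric_space_pts] by auto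
  have "inj_on f (mspace ?M)"
    using inj_on_to_nat_on[OF countable_pts[of 0]] by (auto simp: M f_def inj_on_def)
  moreover have "param ?M (pts 0) dst id"
    by (simp add: param_def M)
  ultimately have "param (relabel f ?M) (pts 0) dst (f \<circ> id)"
    by (intro param_relabel)
  then show ?thesis by blast
qed

theorem theorem4p10:
  shows "\<exists>(X :: real metric) (e :: real) (\<alpha> :: nat \<Rightarrow> real).
           e \<in> mspace X \<and> scaling_factor \<alpha> \<and>
           (\<forall>\<mu>. nonprincipal_ultrafilter \<mu> \<longrightarrow>
              (\<forall>i j. i \<noteq> j \<longrightarrow>
                 \<not> mtopology_of (iterated_cone \<mu> X e \<alpha> i) homeomorphic_space
                   mtopology_of (iterated_cone \<mu> X e \<alpha> j)) \<and>
              countable (asymptotic_cones X // homeomorphism_rel))"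
proof -
  obtain X :: "real metric" and g where X: "param X (pts 0) dst g"
    using model_in_real by blast
  have distinct: "\<not> mtopology_of (iterated_cone \<mu> X (g origin) wt i) homeomorphic_space
      mtopology_of (iterated_cone \<mu> X (g origin) wt j)"
    if \<mu>: "nonprincipal_ultrafilter \<mu>" and "i \<noteq> j" for \<mu> i j
  proof
    \<comment> \<open>The topological invariant: the number of non-isolated points recovers the
      number of iterations.\<close>
    have card: "card (mtopology_of (iterated_cone \<mu> X (g origin) wt k) derived_set_of
        topspace (mtopology_of (iterated_cone \<mu> X (g origin) wt k))) = k" for k
      using iterated_cone_param[OF \<mu> X, of k] card_derived_set by (auto simp: iterated_cone_def)
    assume "mtopology_of (iterated_cone \<mu> X (g origin) wt i) homeomorphic_space
      mtopology_of (iterated_cone \<mu> X (g origin) wt j)"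
    from homeomorphic_card_derived_set[OF this] show False
      using \<open>i \<noteq> j\<close> by (simp only: card)
  qed
  show ?thesis
    using distinct countable_asymptotic_cones[OF X] scaling_factor_wt param_mem[OF X origin_in_pts]
    by (intro exI[of _ X] exI[of _ "g origin"] exI[of _ wt]) blast
qed

end
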